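(* For any $f\in\mathcal{H}$, $$f=\sum_{k=1}^\infty f_k\omega_k,$$ in the absolute sense, where $f_k=\nu_k\langle f,\omega_k\rangle_R$. Furthermore, if $\gamma_k=(\nu_k^{-1}-1)^{-1}$, then $$\langle f,f\rangle_R=\sum_{k=1}^\infty(1+\gamma_k^{-1})f_k^2\qquad\text{and}\qquad\langle Cf,f\rangle_{\mathcal{L}_2}=\sum_{k=1}^\infty f_k^2 .$$ Consequently, $$J(f)=\langle f,f\rangle_R-\langle Cf,f\rangle_{\mathcal{L}_2}=\sum_{k=1}^\infty\gamma_k^{-1}f_k^2 .$$
   Context: $\mathcal{T}$ is a compact subset of a Euclidean space and $\mathcal{L}_2=\mathcal{L}_2(\mathcal{T})$. $\mathcal{H}$ is a reproducing kernel Hilbert space that is a subspace of $\mathcal{L}_2$. $J$ is a squared semi-norm on $\mathcal{H}$ whose null space $\mathcal{H}_0=\{\beta\in\mathcal{H}: J(\beta)=0\}$ is a finite-dimensional linear subspace. $\mathcal{H}_1$ is the orthogonal complement of $\mathcal{H}_0$ in $\mathcal{H}$, with reproducing kernel $K$, assumed continuous and square integrable, and $J(f_1)=\|f_1\|_{\mathcal{H}}^2$ for $f_1\in\mathcal{H}_1$. $X$ is a square integrable random function on $\mathcal{T}$ with covariance function $C(s,t)=E\{[X(s)-E(X(s))][X(t)-E(X(t))]\}$, assumed continuous and square integrable; $C$ also denotes the integral operator $(Cf)(\cdot)=\int_{\mathcal{T}}C(\cdot,t)f(t)\,dt$ on $\mathcal{L}_2$. It is assumed that $Cf\neq0$ for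 any $f\in\mathcal{H}_0$ with $f\neq0$. Under this assumption $\|f\|_R^2=\langle Cf,f\rangle_{\mathcal{L}_2}+J(f)$ defines a norm on $\mathcal{H}$, equivalent to $\|\cdot\|_{\mathcal{H}}$, with inner product $\langle f,g\rangle_R=\frac14(\|f+g\|_R^2-\|f-g\|_R^2)$. $R$ is the reproducing kernel associated with $\|\cdot\|_R$, also viewed as a positive definite integral operator on $\mathcal{L}_2$, and $R^{1/2}$ is its square root (same eigenfunctions as $R$, with eigenvalues the square roots of those of $R$). $\nu_1\ge\nu_2\ge\cdots$ are the eigenvalues of the bounded linear operator $R^{1/2}CR^{1/2}$, $\{\zeta_k:k=1,2,\ldots\}$ are the corresponding orthogonal eigenfunctions in $\mathcal{L}_2$, normalized so that $\langle\zeta_j,\zeta_k\rangle_{\mathcal{L}_2}=\delta_{jk}$ (Kronecker's delta), and $\omega_k=\nu_k^{-1/2}R^{1/2}\zeta_k$, $k=1,2,\ldots$.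
   Formalization: All eigenvalues ν_k of R^{1/2}CR^{1/2} are assumed positive (zero is not an eigenvalue); otherwise, e.g. for C≡1 on [0,1] with H a Sobolev space and J(f)=∫f'^2, ω_k is undefined for ν_k=0 and the expansion fails. *)

theory Defs
  imports "HOL-Probability.Probability"
begin

text \<open>
  Elements of L2(T) are represented by square-integrable functions; two of them denote the same
  element iff they agree almost everywhere on \<open>T\<close> with respect to Lebesgue measure.
\<close>

definition L2 :: "'a::euclidean_space set \<Rightarrow> ('a \<Rightarrow> real) set" where
  "L2 T = {f \<in> borel_measurable (lebesgue_on T). integrable (lebesgue_on T) (\<lambda>t. (f t)\<^sup>2)}"

definition eq_L2 :: "'a::euclidean_space set \<Rightarrow> ('a \<Rightarrow> real) \<Rightarrow> ('a \<Rightarrow> real) \<Rightarrow> bool" where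
  "eq_L2 T f g \<longleftrightarrow> (AE t in lebesgue_on T. f t = g t)"

definition inner_L2 :: "'a::euclidean_space set \<Rightarrow> ('a \<Rightarrow> real) \<Rightarrow> ('a \<Rightarrow> real) \<Rightarrow> real" where
  "inner_L2 T f g = (LINT t|lebesgue_on T. f t * g t)"

definition norm_L2 :: "'a::euclidean_space set \<Rightarrow> ('a \<Rightarrow> real) \<Rightarrow> real" where
  "norm_L2 T f = sqrt (inner_L2 T f f)"

definition continuous_L2_kernel :: "'a::euclidean_space set \<Rightarrow> ('a \<Rightarrow> 'a \<Rightarrow> real) \<Rightarrow> bool" where
  "continuous_L2_kernel T k \<longleftrightarrow>
     continuous_on (T \<times> T) (\<lambda>(s, t). k s t) \<and>
     integrable (lebesgue_on (T \<times> T)) (\<lambda>(s, t). (k s t)\<^sup>2)"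

definition integral_op ::
    "'a::euclidean_space set \<Rightarrow> ('a \<Rightarrow> 'a \<Rightarrow> real) \<Rightarrow> ('a \<Rightarrow> real) \<Rightarrow> 'a \<Rightarrow> real" where
  "integral_op T k f s = (LINT t|lebesgue_on T. k s t * f t)"

text \<open>Compatibility with a.e. equality follows from linearity up to a.e. equality and boundedness.\<close>

definition bounded_linear_L2 ::
    "'a::euclidean_space set \<Rightarrow> (('a \<Rightarrow> real) \<Rightarrow> 'a \<Rightarrow> real) \<Rightarrow> bool" where
  "bounded_linear_L2 T A \<longleftrightarrow>
     (\<forall>f\<in>L2 T. A f \<in> L2 T) \<and>
     (\<forall>f\<in>L2 T. \<forall>g\<in>L2 T. \<forall>a b.
        eq_L2 T (A (\<lambda>t. a * f t + b * g t)) (\<lambda>t. a * A f t + b * A g t)) \<and>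
     (\<exists>B. \<forall>f\<in>L2 T. norm_L2 T (A f) \<le> B * norm_L2 T f)"

text \<open>
  For a positive compact self-adjoint \<open>A\<close>, whose eigenfunctions span L2(T), this determines the
  bounded operator \<open>S\<close> uniquely as an operator on L2(T).
\<close>

definition is_sqrt_op ::
    "'a::euclidean_space set \<Rightarrow> (('a \<Rightarrow> real) \<Rightarrow> 'a \<Rightarrow> real) \<Rightarrow>
     (('a \<Rightarrow> real) \<Rightarrow> 'a \<Rightarrow> real) \<Rightarrow> bool" where
  "is_sqrt_op T A S \<longleftrightarrow>
     bounded_linear_L2 T S \<and>
     (\<forall>g\<in>L2 T. \<forall>\<rho>\<ge>0.
        eq_L2 T (A g) (\<lambda>t. \<rho> * g t) \<longleftrightarrow> eq_L2 T (S g) (\<lambda>t. sqrt \<rho> * g t))"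

text \<open>
  \<open>\<nu>\<close> lists the eigenvalues of \<open>A\<close> in decreasing order (starting at index 0) with orthonormal
  eigenfunctions \<open>\<zeta>\<close>.  The last clause says that each eigenvalue, including a possible eigenvalue 0,
  is listed with its full multiplicity: the \<open>\<zeta> k\<close> with \<open>\<nu> k = c\<close> form a maximal orthonormal
  system in the eigenspace of \<open>c\<close>.
\<close>

definition eigensystem_L2 ::
    "'a::euclidean_space set \<Rightarrow> (('a \<Rightarrow> real) \<Rightarrow> 'a \<Rightarrow> real) \<Rightarrow>
     (nat \<Rightarrow> real) \<Rightarrow> (nat \<Rightarrow> 'a \<Rightarrow> real) \<Rightarrow> bool" where
  "eigensystem_L2 T A \<nu> \<zeta> \<longleftrightarrow>
     decseq \<nu> \<and>
     (\<forall>k. \<zeta> k \<in> L2 T \<and> eq_L2 T (A (\<zeta> k)) (\<lambda>t. \<nu> k * \<zeta> k t)) \<and>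
     (\<forall>j k. inner_L2 T (\<zeta> j) (\<zeta> k) = (if j = k then 1 else 0)) \<and>
     (\<forall>c. \<forall>g\<in>L2 T. eq_L2 T (A g) (\<lambda>t. c * g t) \<longrightarrow>
        (\<forall>k. \<nu> k = c \<longrightarrow> inner_L2 T g (\<zeta> k) = 0) \<longrightarrow> eq_L2 T g (\<lambda>_. 0))"

text \<open>
  A reproducing kernel Hilbert space of functions on \<open>T\<close> is given by a Hilbert space \<open>'h\<close> together
  with its evaluation map \<open>val\<close>: \<open>val f t\<close> is the value of \<open>f\<close> at \<open>t \<in> T\<close>; values outside \<open>T\<close> are
  irrelevant.  Being a subspace of L2(T) includes that an element vanishing almost everywhere is 0.
\<close>

definition rkhs_subspace_L2 ::
    "'a::euclidean_space set \<Rightarrow> ('h::{real_inner, complete_space} \<Rightarrow> 'a \<Rightarrow> real) \<Rightarrow> bool" where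
  "rkhs_subspace_L2 T val \<longleftrightarrow>
     (\<forall>t\<in>T. bounded_linear (\<lambda>f. val f t)) \<and>
     (\<forall>f. val f \<in> L2 T) \<and>
     (\<forall>f. eq_L2 T (val f) (\<lambda>_. 0) \<longrightarrow> f = 0)"

definition reproducing_kernel ::
    "'a set \<Rightarrow> ('h \<Rightarrow> 'a \<Rightarrow> real) \<Rightarrow> 'h set \<Rightarrow> ('h \<Rightarrow> 'h \<Rightarrow> real) \<Rightarrow> ('a \<Rightarrow> 'a \<Rightarrow> real) \<Rightarrow> bool" where
  "reproducing_kernel T val V ip k \<longleftrightarrow>
     (\<forall>t\<in>T. \<exists>h\<in>V. (\<forall>s\<in>T. val h s = k s t) \<and> (\<forall>f\<in>V. val f t = ip f h))"

text \<open>The element of the RKHS that represents a given member of L2(T).\<close>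

definition of_L2 ::
    "'a::euclidean_space set \<Rightarrow> ('h \<Rightarrow> 'a \<Rightarrow> real) \<Rightarrow> ('a \<Rightarrow> real) \<Rightarrow> 'h" where
  "of_L2 T val g = (THE h. eq_L2 T (val h) g)"

definition seminorm :: "('h::real_vector \<Rightarrow> real) \<Rightarrow> bool" where
  "seminorm p \<longleftrightarrow>
     (\<forall>f g. p (f + g) \<le> p f + p g) \<and> (\<forall>c f. p (c *\<^sub>R f) = \<bar>c\<bar> * p f)"

definition squared_seminorm :: "('h::real_vector \<Rightarrow> real) \<Rightarrow> bool" where
  "squared_seminorm J \<longleftrightarrow> (\<exists>p. seminorm p \<and> (\<forall>f. J f = (p f)\<^sup>2))"

definition null_space :: "('h \<Rightarrow> real) \<Rightarrow> 'h set" where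
  "null_space J = {f. J f = 0}"

definition orth_complement :: "'h::real_inner set \<Rightarrow> 'h set" where
  "orth_complement V = {f. \<forall>g\<in>V. orthogonal f g}"

definition finite_dim_subspace :: "'h::real_vector set \<Rightarrow> bool" where
  "finite_dim_subspace V \<longleftrightarrow> (\<exists>B. finite B \<and> V = span B)"

definition square_integrable_process ::
    "'a::euclidean_space set \<Rightarrow> 'w measure \<Rightarrow> ('w \<Rightarrow> 'a \<Rightarrow> real) \<Rightarrow> bool" where
  "square_integrable_process T M X \<longleftrightarrow>
     (\<lambda>(w, t). X w t) \<in> borel_measurable (M \<Otimes>\<^sub>M lebesgue_on T) \<and>
     integrable (M \<Otimes>\<^sub>M lebesgue_on T) (\<lambda>(w, t). (X w t)\<^sup>2) \<and>
     (\<forall>t\<in>T. integrable M (\<lambda>w. (X w t)\<^sup>2))"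

definition covariance :: "'w measure \<Rightarrow> ('w \<Rightarrow> 'a \<Rightarrow> real) \<Rightarrow> 'a \<Rightarrow> 'a \<Rightarrow> real" where
  "covariance M X s t =
     (LINT w|M. (X w s - (LINT w'|M. X w' s)) * (X w t - (LINT w'|M. X w' t)))"

definition quad_R ::
    "'a::euclidean_space set \<Rightarrow> ('h \<Rightarrow> 'a \<Rightarrow> real) \<Rightarrow> ('a \<Rightarrow> 'a \<Rightarrow> real) \<Rightarrow> ('h \<Rightarrow> real) \<Rightarrow>
     'h \<Rightarrow> real" where
  "quad_R T val C J f = inner_L2 T (integral_op T C (val f)) (val f) + J f"

definition inner_R ::
    "'a::euclidean_space set \<Rightarrow> ('h::real_vector \<Rightarrow> 'a \<Rightarrow> real) \<Rightarrow> ('a \<Rightarrow> 'a \<Rightarrow> real) \<Rightarrow>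
     ('h \<Rightarrow> real) \<Rightarrow> 'h \<Rightarrow> 'h \<Rightarrow> real" where
  "inner_R T val C J f g = (quad_R T val C J (f + g) - quad_R T val C J (f - g)) / 4"

end

theory Submission
  imports Defs "HOL-Complex_Analysis.Great_Picard"
begin

text \<open>
  Let \<open>\<iota>\<close> be the inclusion of the space with norm \<open>\<parallel>\<cdot>\<parallel>\<^sub>R\<close> into L2. The kernel operator is \<open>R = \<iota> \<iota>\<^sup>*\<close>, and
  \<open>R\<^sup>1\<^sup>/\<^sup>2\<close> maps L2 onto the range of \<open>\<iota>\<close>, isometrically for \<open>\<parallel>\<cdot>\<parallel>\<^sub>R\<close>. Hence the elements \<open>u\<^sub>k\<close> with
  \<open>\<iota> u\<^sub>k = R\<^sup>1\<^sup>/\<^sup>2 \<zeta>\<^sub>k\<close> form an orthonormal basis for \<open>\<langle>\<cdot>,\<cdot>\<rangle>\<^sub>R\<close>, the \<open>\<zeta>\<^sub>k\<close> being complete by the spectral theorem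
  for the compact operator \<open>R\<^sup>1\<^sup>/\<^sup>2 C R\<^sup>1\<^sup>/\<^sup>2\<close>. Since \<open>\<langle>C f, u\<^sub>k\<rangle> = \<nu>\<^sub>k \<langle>f, u\<^sub>k\<rangle>\<^sub>R\<close>, Parseval's identity gives all the
  formulas. Compactness of \<open>\<iota>\<close> comes from Arzela-Ascoli on \<open>\<H>\<^sub>1\<close> and finite dimension of \<open>\<H>\<^sub>0\<close>; it also gives
  the equivalence of \<open>\<parallel>\<cdot>\<parallel>\<^sub>R\<close> with the norm of \<open>\<H>\<close>. Absolute convergence in L2 rests on the finite trace
  \<open>\<Sum>\<^sub>k \<parallel>\<iota> u\<^sub>k\<parallel>\<^sup>2 \<le> \<integral> R(t, t) dt\<close>.
\<close>

subsection \<open>Compact operators\<close>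

text \<open>The type \<open>'h\<close> carries its own inner product, so the R inner product enters
  as a second, coercive bilinear form \<open>B\<close> on the same type. Adjoints, Bessel and
  expansions are proved for such forms, and convergence is always meant in the given norm. Two
  hypotheses say less than the argument needs. \<open>sqrtR\<close> is prescribed only on
  eigenfunctions of \<open>R\<close>; that its square is \<open>R\<close> and that it is
  self-adjoint has to come from the density of these eigenfunctions. Likewise the eigensystem is
  maximal only within each single eigenspace, so totality has to come from an existence theorem for
  eigenvectors on the orthogonal complement of all \<open>\<zeta> k\<close>. Since every
  \<open>\<nu> k\<close> is positive, a vector annihilated by the product operator is orthogonal to
  all \<open>\<zeta> k\<close>; this is how it is seen that no part of \<open>f\<close> is lost.
  Functions in the null space of \<open>J\<close> are merely square integrable, so evaluation at
  \<open>t\<close> is bounded by a square-integrable function of \<open>t\<close> instead of a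
  constant. Summed squares \<open>u_k(t)^2\<close> are bounded by Bessel applied to the representer
  of evaluation at \<open>t\<close>, and then integrated.\<close>

definition compact_operator :: "('a::real_normed_vector \<Rightarrow> 'b::real_normed_vector) \<Rightarrow> bool" where
  "compact_operator f \<longleftrightarrow> bounded_linear f \<and>
     (\<forall>x::nat \<Rightarrow> 'a. bounded (range x) \<longrightarrow> (\<exists>r. strict_mono r \<and> convergent (\<lambda>n. f (x (r n)))))"

lemma compact_operatorD:
  fixes x :: "nat \<Rightarrow> 'a::real_normed_vector"
  assumes "compact_operator f" and "\<And>n. norm (x n) \<le> b"
  shows "\<exists>r l. strict_mono r \<and> (\<lambda>n. f (x (r n))) \<longlonglongrightarrow> l"
proof -
  have "bounded (range x)"
    using assms(2) by (auto simp: bounded_iff)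
  then show ?thesis
    using assms(1) unfolding compact_operator_def convergent_def by blast
qed

lemma compact_operatorI:
  assumes "bounded_linear f"
    and "\<And>x::nat \<Rightarrow> 'a::real_normed_vector. \<And>b. (\<And>n. norm (x n) \<le> b) \<Longrightarrow>
      \<exists>r l. strict_mono r \<and> (\<lambda>n. f (x (r n))) \<longlonglongrightarrow> l"
  shows "compact_operator f"
  unfolding compact_operator_def
proof (intro conjI allI impI)
  fix x :: "nat \<Rightarrow> 'a"
  assume "bounded (range x)"
  then obtain b where "\<And>n. norm (x n) \<le> b"
    by (auto simp: bounded_iff)
  then show "\<exists>r. strict_mono r \<and> convergent (\<lambda>n. f (x (r n)))"
    using assms(2) unfolding convergent_def by blast
qed (fact assms(1))

lemma compact_operator_bounded_linear: "compact_operator f \<Longrightarrow> bounded_linear f"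
  by (simp add: compact_operator_def)

lemma compact_operator_compose_left:
  fixes f :: "'a::real_normed_vector \<Rightarrow> 'b::real_normed_vector"
  assumes "compact_operator f" and "bounded_linear g"
  shows "compact_operator (\<lambda>x. g (f x))"
proof (rule compact_operatorI)
  show "bounded_linear (\<lambda>x. g (f x))"
    using assms by (intro bounded_linear_compose[OF assms(2)] compact_operator_bounded_linear)
  fix x :: "nat \<Rightarrow> 'a" and b assume "\<And>n. norm (x n) \<le> b"
  then obtain r l where "strict_mono r" and "(\<lambda>n. f (x (r n))) \<longlonglongrightarrow> l"
    using compact_operatorD[of f x b] assms(1) by blast
  then show "\<exists>r l. strict_mono r \<and> (\<lambda>n. g (f (x (r n)))) \<longlonglongrightarrow> l"
    using bounded_linear.tendsto[OF assms(2)] by blast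
qed

lemma compact_operator_compose_right:
  fixes g :: "'a::real_normed_vector \<Rightarrow> 'b::real_normed_vector"
  assumes "compact_operator f" and "bounded_linear g"
  shows "compact_operator (\<lambda>x. f (g x))"
proof (rule compact_operatorI)
  show "bounded_linear (\<lambda>x. f (g x))"
    using assms bounded_linear_compose compact_operator_bounded_linear by blast
  fix x :: "nat \<Rightarrow> 'a" and b assume x: "\<And>n. norm (x n) \<le> b"
  obtain K where K: "\<And>y. norm (g y) \<le> norm y * K" "K \<ge> 0"
    using bounded_linear.nonneg_bounded[OF assms(2)] by blast
  have "norm (g (x n)) \<le> b * K" for n
    using K x[of n] by (meson mult_right_mono order_trans)
  then show "\<exists>r l. strict_mono r \<and> (\<lambda>n. f (g (x (r n)))) \<longlonglongrightarrow> l"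
    using compact_operatorD[of f "\<lambda>n. g (x n)" "b * K"] assms(1) by blast
qed

lemma compact_operator_add:
  fixes f :: "'a::real_normed_vector \<Rightarrow> 'b::real_normed_vector"
  assumes "compact_operator f" and "compact_operator g"
  shows "compact_operator (\<lambda>x. f x + g x)"
proof (rule compact_operatorI)
  show "bounded_linear (\<lambda>x. f x + g x)"
    using assms by (intro bounded_linear_add compact_operator_bounded_linear)
  fix x :: "nat \<Rightarrow> 'a" and b assume x: "\<And>n. norm (x n) \<le> b"
  obtain r l where r: "strict_mono r" "(\<lambda>n. f (x (r n))) \<longlonglongrightarrow> l"
    using compact_operatorD[of f x b] assms(1) x by blast
  obtain q m where q: "strict_mono q" "(\<lambda>n. g (x (r (q n)))) \<longlonglongrightarrow> m"
    using compact_operatorD[of g "\<lambda>n. x (r n)" b] assms(2) x by blast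
  have "(\<lambda>n. f (x (r (q n)))) \<longlonglongrightarrow> l"
    using LIMSEQ_subseq_LIMSEQ[OF r(2) q(1)] by (simp add: o_def)
  then have "(\<lambda>n. f (x ((r \<circ> q) n)) + g (x ((r \<circ> q) n))) \<longlonglongrightarrow> l + m"
    using q(2) by (simp add: tendsto_add)
  then show "\<exists>r l. strict_mono r \<and> (\<lambda>n. f (x (r n)) + g (x (r n))) \<longlonglongrightarrow> l"
    using strict_mono_o[OF r(1) q(1)] by blast
qed

lemma compact_operator_zero: "compact_operator (\<lambda>x. 0)"
  by (rule compact_operatorI) (auto intro: exI[of _ "id"] strict_mono_id)

lemma compact_operator_sum:
  assumes "finite I" and "\<And>i. i \<in> I \<Longrightarrow> compact_operator (f i)"
  shows "compact_operator (\<lambda>x. \<Sum>i\<in>I. f i x)"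
  using assms
  by (induction I rule: finite_induct) (auto intro: compact_operator_zero compact_operator_add)

lemma compact_operator_rank_one:
  fixes \<phi> :: "'a::real_normed_vector \<Rightarrow> real"
  assumes "bounded_linear \<phi>"
  shows "compact_operator (\<lambda>x. \<phi> x *\<^sub>R a)"
proof -
  have "compact_operator \<phi>"
  proof (rule compact_operatorI)
    fix x :: "nat \<Rightarrow> 'a" and b assume x: "\<And>n. norm (x n) \<le> b"
    obtain K where K: "\<And>y. norm (\<phi> y) \<le> norm y * K" "K \<ge> 0"
      using bounded_linear.nonneg_bounded[OF assms] by blast
    have "norm (\<phi> (x n)) \<le> b * K" for n
      using K x[of n] by (meson mult_right_mono order_trans)
    then have "bounded (range (\<lambda>n. \<phi> (x n)))"
      by (auto simp: bounded_iff)
    then show "\<exists>r l. strict_mono r \<and> (\<lambda>n. \<phi> (x (r n))) \<longlonglongrightarrow> l"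
      using bounded_imp_convergent_subsequence[of "\<lambda>n. \<phi> (x n)"] by (auto simp: o_def)
  qed (fact assms)
  then show ?thesis
    by (rule compact_operator_compose_left) (rule bounded_linear_scaleR_left)
qed

subsection \<open>Coercive forms\<close>

lemma bounded_bilinear_add:
  assumes "bounded_bilinear f" and "bounded_bilinear g"
  shows "bounded_bilinear (\<lambda>x y. f x y + g x y)"
proof -
  interpret f: bounded_bilinear f by (fact assms(1))
  interpret g: bounded_bilinear g by (fact assms(2))
  obtain K L where K: "\<And>a b. norm (f a b) \<le> norm a * norm b * K"
    and L: "\<And>a b. norm (g a b) \<le> norm a * norm b * L"
    using f.bounded g.bounded by blast
  have "norm (f a b + g a b) \<le> norm a * norm b * (K + L)" for a b
    using norm_triangle_ineq[of "f a b" "g a b"] K[of a b] L[of a b]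
    unfolding distrib_left by linarith
  then show ?thesis
    by unfold_locales
      (auto simp: f.add_left f.add_right g.add_left g.add_right f.scaleR_left f.scaleR_right
        g.scaleR_left g.scaleR_right scaleR_add_right)
qed

lemma subspace_closure:
  fixes V :: "'a::real_normed_vector set"
  assumes "subspace V"
  shows "subspace (closure V)"
proof -
  have "x + y \<in> closure V" if x: "x \<in> closure V" and y: "y \<in> closure V" for x y
  proof -
    obtain f where "\<forall>n. f n \<in> V" "f \<longlonglongrightarrow> x"
      using x closure_sequential[of x V] by auto
    moreover obtain g where "\<forall>n. g n \<in> V" "g \<longlonglongrightarrow> y"
      using y closure_sequential[of y V] by auto
    ultimately show ?thesis
      using assms unfolding closure_sequential
      by (intro exI[of _ "\<lambda>n. f n + g n"]) (auto intro: tendsto_add subspace_add)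
  qed
  moreover have "c *\<^sub>R x \<in> closure V" if x: "x \<in> closure V" for c x
  proof -
    obtain f where "\<forall>n. f n \<in> V" "f \<longlonglongrightarrow> x"
      using x closure_sequential[of x V] by auto
    then show ?thesis
      using assms unfolding closure_sequential
      by (intro exI[of _ "\<lambda>n. c *\<^sub>R f n"]) (auto intro: tendsto_scaleR subspace_scale)
  qed
  moreover have "0 \<in> closure V"
    using closure_subset subspace_0[OF assms] by blast
  ultimately show ?thesis
    unfolding subspace_def by blast
qed

text \<open>Boundedness and \<open>coercive\<close> together make \<open>B x x\<close> the square of
  a norm equivalent to the given one, so that completeness of \<open>'h\<close> can be used for
  it.\<close>

locale coercive_form = bounded_bilinear B
  for B :: "'h::{real_inner, complete_space} \<Rightarrow> 'h \<Rightarrow> real" +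
  fixes \<alpha> :: real
  assumes alpha_pos: "\<alpha> > 0"
    and sym: "B x y = B y x"
    and coercive: "\<alpha> * (norm x)\<^sup>2 \<le> B x x"
begin

lemma form_nonneg: "B x x \<ge> 0"
  using coercive[of x] alpha_pos by (smt (verit) mult_nonneg_nonneg zero_le_power2)

lemma form_eq_zero: "B x x = 0 \<Longrightarrow> x = 0"
  using coercive[of x] alpha_pos by (simp add: mult_le_0_iff)

text \<open>The minimiser over \<open>V\<close> of the energy \<open>B v v - 2 * \<phi> v\<close>
  satisfies the Euler equation. \<open>V = UNIV\<close> gives Riesz representation, hence adjoints;
  \<open>\<phi> = B x\<close> gives the \<open>B\<close>-orthogonal projection of \<open>x\<close>
  onto \<open>V\<close>.\<close>

lemma representer:
  assumes V: "subspace V" "closed V" and \<phi>: "bounded_linear \<phi>"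
  shows "\<exists>v\<in>V. \<forall>w\<in>V. B v w = \<phi> w"
proof -
  interpret phi: bounded_linear \<phi> by (fact \<phi>)
  obtain K where K: "\<And>y. norm (\<phi> y) \<le> norm y * K" "K \<ge> 0"
    using bounded_linear.nonneg_bounded[OF \<phi>] by blast
  define q where "q v = B v v - 2 * \<phi> v" for v
  define m where "m = Inf (q ` V)"
  \<comment> \<open>Completing the square: \<open>q v\<close> is at least
    \<open>\<alpha> * r^2 - 2 * K * r\<close> with \<open>r = norm v\<close>, and this is smallest
    at \<open>r = K / \<alpha>\<close>.\<close>
  have "q v \<ge> - (K\<^sup>2 / \<alpha>)" for v
  proof -
    have "\<phi> v \<le> norm v * K"
      using K(1)[of v] by auto
    moreover have "(\<alpha> * norm v - K)\<^sup>2 / \<alpha> \<ge> 0"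
      using alpha_pos by simp
    then have "\<alpha> * (norm v)\<^sup>2 - 2 * (norm v * K) + K\<^sup>2 / \<alpha> \<ge> 0"
      using alpha_pos by (simp add: power2_eq_square field_simps)
    ultimately show ?thesis
      using coercive[of v] unfolding q_def by linarith
  qed
  then have bdd: "bdd_below (q ` V)"
    by (auto intro!: bdd_belowI)
  have m_le: "m \<le> q v" if "v \<in> V" for v
    unfolding m_def using bdd that by (auto intro: cInf_lower)
  have "\<exists>v\<in>V. q v < m + inverse (real (Suc n))" for n
  proof -
    have "q ` V \<noteq> {}"
      using subspace_0[OF V(1)] by auto
    then show ?thesis
      using cInf_lessD[of "q ` V" "m + inverse (real (Suc n))"] unfolding m_def by auto
  qed
  then obtain v where v: "\<And>n. v n \<in> V" "\<And>n. q (v n) < m + inverse (real (Suc n))"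
    by metis
  \<comment> \<open>Parallelogram identity: the midpoint stays in \<open>V\<close>, where
    \<open>q\<close> is at least \<open>m\<close>, so two near-minimisers are close to each
    other.\<close>
  have close: "(norm (v i - v j))\<^sup>2 \<le> (2 / \<alpha>) * (inverse (real (Suc i)) + inverse (real (Suc j)))" for i j
  proof -
    have mid: "(1/2) *\<^sub>R (v i + v j) \<in> V"
      using v V by (simp add: subspace_add subspace_scale)
    have "B (v i - v j) (v i - v j) = 2 * q (v i) + 2 * q (v j) - 4 * q ((1/2) *\<^sub>R (v i + v j))"
      unfolding q_def
      by (simp add: add_left add_right diff_left diff_right scaleR_left scaleR_right phi.add phi.scaleR
          sym[of "v j" "v i"] field_simps)
    also have "\<dots> \<le> 2 * (inverse (real (Suc i)) + inverse (real (Suc j)))"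
      using v(2)[of i] v(2)[of j] m_le[OF mid] unfolding distrib_left by linarith
    finally have "\<alpha> * (norm (v i - v j))\<^sup>2 \<le> 2 * (inverse (real (Suc i)) + inverse (real (Suc j)))"
      using coercive order_trans by blast
    then show ?thesis
      using alpha_pos by (simp add: pos_le_divide_eq mult.commute del: of_nat_Suc)
  qed
  have "Cauchy v"
  proof (rule CauchyI)
    fix e :: real assume "e > 0"
    then have "e\<^sup>2 * \<alpha> / 4 > 0"
      using alpha_pos by simp
    then obtain N where N: "inverse (real (Suc N)) < e\<^sup>2 * \<alpha> / 4"
      using reals_Archimedean by blast
    have "norm (v i - v j) < e" if "i \<ge> N" "j \<ge> N" for i j
    proof -
      have "inverse (real (Suc i)) \<le> inverse (real (Suc N))"
           "inverse (real (Suc j)) \<le> inverse (real (Suc N))"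
        using that by (auto simp: field_simps)
      then have "inverse (real (Suc i)) + inverse (real (Suc j)) < e\<^sup>2 * \<alpha> / 2"
        using N by linarith
      then have "(2 / \<alpha>) * (inverse (real (Suc i)) + inverse (real (Suc j))) < e\<^sup>2"
        using alpha_pos by (simp add: pos_divide_less_eq mult.commute del: of_nat_Suc)
      then have "(norm (v i - v j))\<^sup>2 < e\<^sup>2"
        using close[of i j] by linarith
      then show ?thesis
        using \<open>e > 0\<close> by (simp add: power2_less_imp_less)
    qed
    then show "\<exists>M. \<forall>m\<ge>M. \<forall>n\<ge>M. norm (v m - v n) < e"
      by blast
  qed
  then obtain l where l: "v \<longlonglongrightarrow> l"
    using Cauchy_convergent convergent_def by blast
  have "l \<in> V"
    using closed_sequentially[OF V(2)] v(1) l by blast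
  have "(\<lambda>n. q (v n)) \<longlonglongrightarrow> q l"
    unfolding q_def using l by (intro tendsto_intros tendsto phi.tendsto)
  moreover have "(\<lambda>n. m + inverse (real (Suc n))) \<longlonglongrightarrow> m + 0"
    by (intro tendsto_intros LIMSEQ_inverse_real_of_nat)
  ultimately have "q l \<le> m"
    using LIMSEQ_le[of "\<lambda>n. q (v n)" "q l" "\<lambda>n. m + inverse (real (Suc n))"] v(2) by (auto intro: less_imp_le)
  have "B l w = \<phi> w" if "w \<in> V" for w
  proof (cases "w = 0")
    case True
    then show ?thesis by (simp add: zero_right phi.zero)
  next
    case False
    define d where "d = B l w - \<phi> w"
    define b where "b = B w w"
    have "b > 0"
      using False form_nonneg[of w] form_eq_zero[of w] unfolding b_def by fastforce
    \<comment> \<open>The minimiser of \<open>q\<close> along the line through \<open>l\<close> in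
      direction \<open>w\<close>; it would lower \<open>q l\<close> by
      \<open>d^2 / b\<close>.\<close>
    define t where "t = - d / b"
    have "l + t *\<^sub>R w \<in> V"
      using \<open>l \<in> V\<close> that V by (simp only: subspace_add subspace_scale)
    then have "q l \<le> q (l + t *\<^sub>R w)"
      using \<open>q l \<le> m\<close> m_le by force
    also have "\<dots> = q l + t\<^sup>2 * b + 2 * t * d"
      unfolding q_def d_def b_def
      by (simp add: add_left add_right scaleR_left scaleR_right phi.add phi.scaleR sym[of w l]
          power2_eq_square algebra_simps)
    also have "\<dots> = q l - d\<^sup>2 / b"
      using \<open>b > 0\<close> by (simp add: t_def power2_eq_square)
    finally have "d\<^sup>2 / b \<le> 0"
      by simp
    then have "d = 0"
      using \<open>b > 0\<close> by (simp add: divide_le_0_iff)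
    then show ?thesis
      by (simp add: d_def)
  qed
  then show ?thesis
    using \<open>l \<in> V\<close> by blast
qed

text \<open>Subtracting from \<open>x\<close> its \<open>B\<close>-projection onto the closure of
  \<open>V\<close> leaves a vector orthogonal to \<open>V\<close>.\<close>

lemma dense_subspace:
  assumes "subspace V" and "\<And>x. (\<And>v. v \<in> V \<Longrightarrow> B x v = 0) \<Longrightarrow> x = 0"
  shows "closure V = UNIV"
proof -
  have "x \<in> closure V" for x
  proof -
    obtain v where v: "v \<in> closure V" "\<And>w. w \<in> closure V \<Longrightarrow> B v w = B x w"
      using representer[OF subspace_closure[OF assms(1)] closed_closure bounded_linear_right[of x]] by auto
    have "B (x - v) w = 0" if "w \<in> V" for w
      using v(2)[of w] that closure_subset[of V] by (auto simp: diff_left)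
    then have "x - v = 0"
      using assms(2) by blast
    then show ?thesis using v(1) by simp
  qed
  then show ?thesis by blast
qed

lemma Bessel:
  fixes u :: "nat \<Rightarrow> 'h"
  assumes "\<And>j k. B (u j) (u k) = (if j = k then 1 else 0)"
  shows "(\<Sum>k<n. (B f (u k))\<^sup>2) \<le> B f f"
proof -
  define g where "g = (\<Sum>k<n. B f (u k) *\<^sub>R u k)"
  have fg: "B f g = (\<Sum>k<n. (B f (u k))\<^sup>2)"
    unfolding g_def by (simp add: sum_right scaleR_right power2_eq_square)
  have "B g (u k) = B f (u k)" if "k < n" for k
    unfolding g_def using that by (simp add: sum_left scaleR_left assms if_distrib cong: if_cong)
  then have "B g g = (\<Sum>k<n. (B f (u k))\<^sup>2)"
    by (subst (2) g_def) (simp add: sum_right scaleR_right power2_eq_square)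
  then have "B (f - g) (f - g) = B f f - (\<Sum>k<n. (B f (u k))\<^sup>2)"
    by (simp add: diff_left diff_right fg sym[of g f])
  then show ?thesis
    using form_nonneg[of "f - g"] by simp
qed

lemma Bessel_summable:
  fixes u :: "nat \<Rightarrow> 'h"
  assumes "\<And>j k. B (u j) (u k) = (if j = k then 1 else 0)"
  shows "summable (\<lambda>k. (B f (u k))\<^sup>2)"
  by (rule summableI_nonneg_bounded[where x = "B f f"]) (auto intro: Bessel[OF assms])

text \<open>Coercivity bounds the norm of a block of the series by a block of the Bessel series, so
  the partial sums converge. The limit has the same coefficients as \<open>f\<close>, and
  \<open>total\<close> identifies the two.\<close>

lemma orthonormal_expansion:
  fixes u :: "nat \<Rightarrow> 'h"
  assumes orth: "\<And>j k. B (u j) (u k) = (if j = k then 1 else 0)"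
    and total: "\<And>f. (\<And>k. B f (u k) = 0) \<Longrightarrow> f = 0"
  shows "(\<lambda>k. B f (u k) *\<^sub>R u k) sums f"
proof -
  define s where "s n = (\<Sum>k<n. B f (u k) *\<^sub>R u k)" for n
  have norm_diff: "\<alpha> * (norm (s j - s i))\<^sup>2 \<le> (\<Sum>k=i..<j. (B f (u k))\<^sup>2)" if "i \<le> j" for i j
  proof -
    have e: "s j - s i = (\<Sum>k=i..<j. B f (u k) *\<^sub>R u k)"
      unfolding s_def using sum_diff_nat_ivl[of 0 i j] that by (simp add: atLeast0LessThan)
    have "B (s j - s i) (u k) = B f (u k)" if "k \<in> {i..<j}" for k
      unfolding e using that by (simp add: sum_left scaleR_left orth if_distrib cong: if_cong)
    then have "B (s j - s i) (s j - s i) = (\<Sum>k=i..<j. (B f (u k))\<^sup>2)"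
      by (subst (2) e) (simp add: sum_right scaleR_right power2_eq_square)
    then show ?thesis
      using coercive[of "s j - s i"] by simp
  qed
  have "Cauchy s"
  proof (rule CauchyI')
    fix e :: real assume "e > 0"
    then have "\<alpha> * e\<^sup>2 > 0" using alpha_pos by simp
    then obtain N where N: "\<And>m n. m \<ge> N \<Longrightarrow> norm (\<Sum>k=m..<n. (B f (u k))\<^sup>2) < \<alpha> * e\<^sup>2"
      using Bessel_summable[OF orth, of f] unfolding summable_Cauchy by meson
    have "dist (s m) (s n) < e" if "m \<ge> N" "n > m" for m n
    proof -
      have "\<alpha> * (norm (s n - s m))\<^sup>2 < \<alpha> * e\<^sup>2"
        using norm_diff[of m n] N[of m n] that by auto
      then have "(norm (s n - s m))\<^sup>2 < e\<^sup>2"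
        using alpha_pos by simp
      then show ?thesis
        using \<open>e > 0\<close> by (simp add: power2_less_imp_less dist_norm norm_minus_commute)
    qed
    then show "\<exists>M. \<forall>m\<ge>M. \<forall>n>m. dist (s m) (s n) < e" by blast
  qed
  then obtain g where g: "s \<longlonglongrightarrow> g"
    using Cauchy_convergent convergent_def by blast
  then have sg: "(\<lambda>k. B f (u k) *\<^sub>R u k) sums g"
    unfolding s_def sums_def by simp
  have "B (f - g) (u k) = 0" for k
  proof -
    have "(\<lambda>j. B (B f (u j) *\<^sub>R u j) (u k)) sums B g (u k)"
      by (rule bounded_linear.sums[OF bounded_linear_left sg])
    moreover have "(\<lambda>j. if j = k then B f (u j) else 0) sums B f (u k)"
      by (rule sums_single)
    moreover have "(\<lambda>j. B (B f (u j) *\<^sub>R u j) (u k)) = (\<lambda>j. if j = k then B f (u j) else 0)"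
      by (auto simp: scaleR_left orth)
    ultimately have "B g (u k) = B f (u k)"
      using sums_unique2 by metis
    then show ?thesis by (simp add: diff_left)
  qed
  then have "f - g = 0" by (rule total)
  then show ?thesis using sg by simp
qed

end

text \<open>Makes the density result available for the inner product itself.\<close>

lemma coercive_form_inner:
  "coercive_form (inner :: 'a::{real_inner, complete_space} \<Rightarrow> 'a \<Rightarrow> real) 1"
  by (intro coercive_form.intro coercive_form_axioms.intro bounded_bilinear_inner)
    (auto simp: inner_commute power2_norm_eq_inner)

lemma (in coercive_form) exists_adjoint:
  fixes \<iota> :: "'h \<Rightarrow> 'l::real_inner"
  assumes "bounded_linear \<iota>"
  shows "\<exists>adj. \<forall>f g. B f (adj g) = \<iota> f \<bullet> g"
proof -
  have "\<exists>v. \<forall>f. B f v = \<iota> f \<bullet> g" for g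
    using representer[of UNIV "\<lambda>f. \<iota> f \<bullet> g"]
      bounded_linear_compose[OF bounded_linear_inner_left assms]
    by (auto simp: sym)
  then show ?thesis by metis
qed

subsection \<open>Compact self-adjoint operators\<close>

lemma bounded_linear_eq_on_dense:
  assumes "bounded_linear f" "bounded_linear g" and "closure (span E) = UNIV"
    and "\<And>e. e \<in> E \<Longrightarrow> f e = g e"
  shows "f x = g x"
proof -
  have "f y = g y" if "y \<in> span E" for y
    using linear_eq_on_span[of f g E] assms that by (auto intro: bounded_linear.linear)
  then have "span E \<subseteq> {y. f y = g y}" by auto
  moreover have "closed {y. f y = g y}"
    using assms by (intro closed_Collect_eq linear_continuous_on)
  ultimately have "closure (span E) \<subseteq> {y. f y = g y}"
    by (rule closure_minimal)
  then show ?thesis using assms(3) by auto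
qed

text \<open>Unit vectors of \<open>V\<close> along which \<open>norm (A x)\<close> tends to its
  supremum \<open>m\<close> are approximate eigenvectors of the square of \<open>A\<close> for
  \<open>m^2\<close>. Compactness makes a subsequence converge to a true one.\<close>

lemma compact_selfadjoint_eigenvector:
  fixes A :: "'l::real_inner \<Rightarrow> 'l"
  assumes compact: "compact_operator A"
    and selfadj: "\<And>x y. A x \<bullet> y = x \<bullet> A y"
    and V: "subspace V" "closed V" and inv: "\<And>x. x \<in> V \<Longrightarrow> A x \<in> V"
    and nonzero: "v \<in> V" "A v \<noteq> 0"
  shows "\<exists>c g. g \<in> V \<and> g \<noteq> 0 \<and> c \<noteq> 0 \<and> A g = c *\<^sub>R g"
proof -
  interpret A: bounded_linear A
    by (rule compact_operator_bounded_linear[OF compact])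
  define W where "W = {x \<in> V. norm x = 1}"
  define m where "m = Sup ((\<lambda>x. norm (A x)) ` W)"
  obtain K where K: "\<And>y. norm (A y) \<le> norm y * K" "K \<ge> 0"
    using A.nonneg_bounded by blast
  have bdd: "bdd_above ((\<lambda>x. norm (A x)) ` W)"
  proof (rule bdd_aboveI)
    fix y assume "y \<in> (\<lambda>x. norm (A x)) ` W"
    then obtain x where "x \<in> W" "y = norm (A x)" by auto
    then show "y \<le> K" using K(1)[of x] unfolding W_def by simp
  qed
  have W_le: "norm (A x) \<le> m" if "x \<in> W" for x
    unfolding m_def using bdd that by (auto intro: cSup_upper)
  have le: "norm (A x) \<le> m * norm x" if "x \<in> V" for x
  proof (cases "x = 0")
    case False
    have "(1 / norm x) *\<^sub>R x \<in> W"
      unfolding W_def using that V False by (auto simp: subspace_scale)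
    from W_le[OF this] False show ?thesis
      by (simp add: A.scaleR field_simps)
  qed (simp add: A.zero)
  have "v \<noteq> 0" using nonzero by (auto simp: A.zero)
  then have vW: "(1 / norm v) *\<^sub>R v \<in> W"
    unfolding W_def using nonzero V by (auto simp: subspace_scale)
  have "m > 0"
    using le[OF nonzero(1)] nonzero(2) by (smt (verit) mult_nonpos_nonneg norm_ge_zero zero_less_norm_iff)
  have "\<exists>x\<in>W. norm (A x) > m - inverse (real (Suc n))" for n
  proof -
    have "m - inverse (real (Suc n)) < m" by simp
    moreover have "(\<lambda>x. norm (A x)) ` W \<noteq> {}" using vW by auto
    ultimately show ?thesis
      unfolding m_def using less_cSupD by (smt (verit) image_iff)
  qed
  then obtain x where x: "\<And>n. x n \<in> W" "\<And>n. norm (A (x n)) > m - inverse (real (Suc n))"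
    by metis
  have xV: "x n \<in> V" "norm (x n) = 1" for n using x(1)[of n] unfolding W_def by auto
  have lim: "(\<lambda>n. norm (A (x n))) \<longlonglongrightarrow> m"
  proof (rule tendsto_sandwich)
    show "(\<lambda>n. m - inverse (real (Suc n))) \<longlonglongrightarrow> m"
      using tendsto_diff[OF tendsto_const LIMSEQ_inverse_real_of_nat, of m] by simp
    show "(\<lambda>n. m) \<longlonglongrightarrow> m" by simp
  qed (use x W_le in \<open>auto intro!: always_eventually less_imp_le simp del: of_nat_Suc\<close>)
  \<comment> \<open>By self-adjointness the mixed term is \<open>norm (A (x n))\<close> squared; the
    first term is bounded by applying \<open>le\<close> to \<open>A (x n)\<close>, which is again in
    \<open>V\<close>.\<close>
  have est: "(norm (A (A (x n)) - m\<^sup>2 *\<^sub>R x n))\<^sup>2 \<le> m\<^sup>2 * (m\<^sup>2 - (norm (A (x n)))\<^sup>2)" for n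
  proof -
    have "(norm (A (A (x n)) - m\<^sup>2 *\<^sub>R x n))\<^sup>2 =
        (norm (A (A (x n))))\<^sup>2 - 2 * m\<^sup>2 * (A (A (x n)) \<bullet> x n) + (m\<^sup>2)\<^sup>2 * (norm (x n))\<^sup>2"
      unfolding power2_norm_eq_inner
      by (simp add: inner_diff_left inner_diff_right inner_commute power2_eq_square)
    also have "A (A (x n)) \<bullet> x n = (norm (A (x n)))\<^sup>2"
      by (simp add: selfadj power2_norm_eq_inner)
    also have "(norm (A (A (x n))))\<^sup>2 \<le> (m * norm (A (x n)))\<^sup>2"
      using le[OF inv[OF xV(1)], of n] by (intro power_mono) auto
    finally show ?thesis
      using xV(2)[of n] by (simp add: power2_eq_square algebra_simps)
  qed
  have "(\<lambda>n. m\<^sup>2 * (m\<^sup>2 - (norm (A (x n)))\<^sup>2)) \<longlonglongrightarrow> m\<^sup>2 * (m\<^sup>2 - m\<^sup>2)"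
    by (intro tendsto_intros lim)
  then have *: "(\<lambda>n. m\<^sup>2 * (m\<^sup>2 - (norm (A (x n)))\<^sup>2)) \<longlonglongrightarrow> 0"
    by simp
  have "(\<lambda>n. (norm (A (A (x n)) - m\<^sup>2 *\<^sub>R x n))\<^sup>2) \<longlonglongrightarrow> 0"
    by (rule tendsto_sandwich[OF _ _ tendsto_const *]) (simp_all add: est)
  then have "(\<lambda>n. sqrt ((norm (A (A (x n)) - m\<^sup>2 *\<^sub>R x n))\<^sup>2)) \<longlonglongrightarrow> sqrt 0"
    by (rule tendsto_real_sqrt)
  then have diff0: "(\<lambda>n. A (A (x n)) - m\<^sup>2 *\<^sub>R x n) \<longlonglongrightarrow> 0"
    by (simp add: tendsto_norm_zero_iff)
  obtain r l where r: "strict_mono r" "(\<lambda>n. A (x (r n))) \<longlonglongrightarrow> l"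
    using compact_operatorD[of A x 1] compact xV(2) by auto
  have "(\<lambda>n. A (A (x (r n))) - m\<^sup>2 *\<^sub>R x (r n)) \<longlonglongrightarrow> 0"
    using LIMSEQ_subseq_LIMSEQ[OF diff0 r(1)] by (simp add: o_def)
  \<comment> \<open>Compactness only gives convergence of the images; as \<open>m > 0\<close>, the
    approximate eigenvalue equation recovers \<open>x (r n)\<close> from them.\<close>
  then have "(\<lambda>n. (1 / m\<^sup>2) *\<^sub>R (A (A (x (r n))) - (A (A (x (r n))) - m\<^sup>2 *\<^sub>R x (r n)))) \<longlonglongrightarrow> (1 / m\<^sup>2) *\<^sub>R (A l - 0)"
    by (intro tendsto_intros A.tendsto r(2))
  then have "(\<lambda>n. x (r n)) \<longlonglongrightarrow> (1 / m\<^sup>2) *\<^sub>R A l"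
    using \<open>m > 0\<close> by simp
  then obtain g where g: "g = (1 / m\<^sup>2) *\<^sub>R A l" and xl: "(\<lambda>n. x (r n)) \<longlonglongrightarrow> g"
    by blast
  have "g \<in> V"
    using closed_sequentially[OF V(2) _ xl] xV(1) by blast
  have "norm g = 1"
    using tendsto_norm[OF xl] xV(2) by (simp add: LIMSEQ_const_iff)
  then have "g \<noteq> 0" by auto
  have "l = A g"
    by (rule LIMSEQ_unique[OF r(2) A.tendsto[OF xl]])
  then have AA: "A (A g) = m\<^sup>2 *\<^sub>R g"
    using \<open>m > 0\<close> by (subst (2) g) simp
  show ?thesis
  proof (cases "A g = m *\<^sub>R g")
    case True
    then show ?thesis using \<open>g \<in> V\<close> \<open>g \<noteq> 0\<close> \<open>m > 0\<close> by (intro exI[of _ m] exI[of _ g]) auto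
  next
    case False
    \<comment> \<open>\<open>(A + m) (A - m) g = 0\<close>: if \<open>g\<close> is not an
      eigenvector for \<open>m\<close>, then \<open>h\<close> is one for \<open>- m\<close>.\<close>
    define h where "h = A g - m *\<^sub>R g"
    have "A h = (- m) *\<^sub>R h"
      unfolding h_def by (simp add: A.diff A.scaleR AA power2_eq_square algebra_simps)
    moreover have "h \<in> V"
      unfolding h_def using V inv \<open>g \<in> V\<close> by (simp add: subspace_diff subspace_scale)
    ultimately show ?thesis
      using False \<open>m > 0\<close> unfolding h_def by (intro exI[of _ "- m"] exI[of _ "A g - m *\<^sub>R g"]) auto
  qed
qed

text \<open>The orthogonal complement of the eigenvectors is closed and invariant, so
  \<open>A\<close> vanishes on it, as it would otherwise contain an eigenvector. But vectors
  annihilated by \<open>A\<close> are eigenvectors for 0.\<close>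

lemma psd_compact_eigenvectors_dense:
  fixes A :: "'l::{real_inner, complete_space} \<Rightarrow> 'l"
  assumes compact: "compact_operator A"
    and selfadj: "\<And>x y. A x \<bullet> y = x \<bullet> A y"
    and psd: "\<And>x. A x \<bullet> x \<ge> 0"
  shows "closure (span {g. \<exists>\<rho>\<ge>0. A g = \<rho> *\<^sub>R g}) = UNIV"
proof (rule coercive_form.dense_subspace[OF coercive_form_inner subspace_span])
  interpret A: bounded_linear A
    by (rule compact_operator_bounded_linear[OF compact])
  define E where "E = {g. \<exists>\<rho>\<ge>0. A g = \<rho> *\<^sub>R g}"
  fix x assume *: "\<And>v. v \<in> span {g. \<exists>\<rho>\<ge>0. A g = \<rho> *\<^sub>R g} \<Longrightarrow> x \<bullet> v = 0"
  have x: "x \<bullet> v = 0" if "v \<in> E" for v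
    using *[OF span_base] that unfolding E_def by simp
  define V where "V = {y. \<forall>v\<in>E. y \<bullet> v = 0}"
  have "A x = 0"
  proof (rule ccontr)
    assume "A x \<noteq> 0"
    moreover have "subspace V"
      unfolding V_def subspace_def by (auto simp: inner_add_left)
    moreover have "closed V"
    proof -
      have "V = (\<Inter>v\<in>E. {y. y \<bullet> v = 0})" unfolding V_def by auto
      moreover have "closed {y. y \<bullet> v = 0}" for v :: 'l
        by (intro closed_Collect_eq continuous_intros)
      ultimately show ?thesis by auto
    qed
    moreover have "A y \<in> V" if "y \<in> V" for y
      using that unfolding V_def E_def by (auto simp: selfadj)
    moreover have "x \<in> V" using x unfolding V_def by blast
    ultimately obtain c g where g: "g \<in> V" "g \<noteq> 0" "A g = c *\<^sub>R g"
      using compact_selfadjoint_eigenvector[OF compact selfadj, of V x] by blast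
    have "c * (g \<bullet> g) \<ge> 0" using psd[of g] g by simp
    moreover have "g \<bullet> g > 0" using g(2) by simp
    ultimately have "c \<ge> 0" by (simp add: zero_le_mult_iff)
    then have "g \<in> E" using g unfolding E_def by blast
    then show False using g unfolding V_def by auto
  qed
  then have "x \<in> E" unfolding E_def by (auto intro: exI[of _ 0])
  then show "x = 0" using x[of x] by simp
qed

text \<open>\<open>S\<close> is known on eigenvectors of \<open>A\<close> only; both identities are
  checked there and extended by density. Self-adjointness on eigenvectors holds because those for
  distinct eigenvalues are orthogonal.\<close>

lemma sqrt_of_psd_compact:
  fixes A S :: "'l::{real_inner, complete_space} \<Rightarrow> 'l"
  assumes compact: "compact_operator A"
    and selfadj: "\<And>x y. A x \<bullet> y = x \<bullet> A y"
    and psd: "\<And>x. A x \<bullet> x \<ge> 0"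
    and S: "bounded_linear S"
    and sqrt: "\<And>\<rho> g. \<rho> \<ge> 0 \<Longrightarrow> A g = \<rho> *\<^sub>R g \<Longrightarrow> S g = sqrt \<rho> *\<^sub>R g"
  shows "S (S x) = A x" and "S x \<bullet> y = x \<bullet> S y"
proof -
  interpret S: bounded_linear S by (fact S)
  define E where "E = {g. \<exists>\<rho>\<ge>0. A g = \<rho> *\<^sub>R g}"
  have dense: "closure (span E) = UNIV"
    unfolding E_def using psd_compact_eigenvectors_dense[OF compact selfadj psd] .
  have "S (S e) = A e" if "e \<in> E" for e
    using that sqrt unfolding E_def by (auto simp: S.scaleR)
  then show "S (S x) = A x"
    using bounded_linear_eq_on_dense[OF _ _ dense, of "\<lambda>x. S (S x)" A]
      bounded_linear_compose[OF S S] compact_operator_bounded_linear[OF compact] by blast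
  have EE: "S e \<bullet> e' = e \<bullet> S e'" if "e \<in> E" "e' \<in> E" for e e'
  proof -
    obtain a b where ab: "a \<ge> 0" "A e = a *\<^sub>R e" "b \<ge> 0" "A e' = b *\<^sub>R e'"
      using \<open>e \<in> E\<close> \<open>e' \<in> E\<close> unfolding E_def by blast
    have "a * (e \<bullet> e') = b * (e \<bullet> e')"
      using selfadj[of e e'] ab by simp
    then have "a = b \<or> e \<bullet> e' = 0" by auto
    then show ?thesis
      using sqrt[OF ab(1,2)] sqrt[OF ab(3,4)] by auto
  qed
  \<comment> \<open>Density is applied to one argument at a time.\<close>
  have 1: "S z \<bullet> e = z \<bullet> S e" if "e \<in> E" for z e
    by (rule bounded_linear_eq_on_dense[OF bounded_linear_compose[OF bounded_linear_inner_left S]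
          bounded_linear_inner_left dense EE[OF _ that]])
  show "S x \<bullet> y = x \<bullet> S y"
    by (rule bounded_linear_eq_on_dense[OF bounded_linear_inner_right
          bounded_linear_compose[OF bounded_linear_inner_right S] dense 1])
qed

text \<open>Starting from a zero of the form, a small step along \<open>- A x\<close> would make it
  negative unless \<open>A x = 0\<close>.\<close>

lemma psd_form_zero:
  fixes A :: "'l::real_inner \<Rightarrow> 'l"
  assumes A: "bounded_linear A" and selfadj: "\<And>x y. A x \<bullet> y = x \<bullet> A y" and psd: "\<And>x. A x \<bullet> x \<ge> 0"
    and zero: "A x \<bullet> x = 0"
  shows "A x = 0"
proof (rule ccontr)
  interpret A: bounded_linear A by (fact A)
  assume "A x \<noteq> 0"
  define n where "n = A x \<bullet> A x"
  define b where "b = A (A x) \<bullet> A x"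
  \<comment> \<open>A step so short that the linear term \<open>2 * s * n\<close> outweighs
    \<open>s^2 * b\<close>; the \<open>+ 1\<close> covers \<open>b = 0\<close>.\<close>
  define s where "s = - n / (b + 1)"
  have "n > 0" unfolding n_def using \<open>A x \<noteq> 0\<close> by simp
  have "b \<ge> 0" unfolding b_def by (rule psd)
  have "A (x + s *\<^sub>R A x) \<bullet> (x + s *\<^sub>R A x) = 2 * s * n + s\<^sup>2 * b"
    unfolding n_def b_def
    by (simp add: A.add A.scaleR inner_add_left inner_add_right zero selfadj[of "A x" x] power2_eq_square
        algebra_simps)
  also have "\<dots> = s * n + s * (n + s * b)"
    by (simp add: power2_eq_square algebra_simps)
  also have "n + s * b = n / (b + 1)"
    unfolding s_def using \<open>b \<ge> 0\<close> by (simp add: field_simps)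
  also have "s * n + s * (n / (b + 1)) < 0"
  proof -
    have "s < 0" unfolding s_def using \<open>n > 0\<close> \<open>b \<ge> 0\<close> by (simp add: divide_neg_pos)
    moreover have "n / (b + 1) > 0" using \<open>n > 0\<close> \<open>b \<ge> 0\<close> by simp
    ultimately have "s * n < 0" "s * (n / (b + 1)) < 0"
      using \<open>n > 0\<close> by (blast intro: mult_neg_pos)+
    then show ?thesis by linarith
  qed
  finally show False
    using psd[of "x + s *\<^sub>R A x"] by simp
qed

subsection \<open>Eigensystem of a factorized operator\<close>

text \<open>
  \<open>adj\<close> is the adjoint \<open>\<iota>\<^sup>*\<close> with respect to \<open>B\<close>, \<open>S\<close> the square root of \<open>\<iota> \<iota>\<^sup>*\<close>, and \<open>\<nu>\<close>, \<open>z\<close> the eigensystem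
  of \<open>S C S\<close>. The conclusion of \<open>complete\<close> is only \<open>S x = 0\<close>, because the eigenfunctions live on \<open>T\<close>
  whereas \<open>'l\<close> will be an L2 space over the whole space.
\<close>

locale factorized_eigensystem = coercive_form B \<alpha>
  for B :: "'h::{real_inner, complete_space} \<Rightarrow> 'h \<Rightarrow> real" and \<alpha> :: real +
  fixes \<iota> :: "'h \<Rightarrow> 'l::{real_inner, complete_space}"
    and adj :: "'l \<Rightarrow> 'h"
    and C S :: "'l \<Rightarrow> 'l"
    and \<nu> :: "nat \<Rightarrow> real"
    and z :: "nat \<Rightarrow> 'l"
  assumes compact_embedding: "compact_operator \<iota>"
    and embedding_inj: "\<iota> f = 0 \<Longrightarrow> f = 0"
    and adj: "B f (adj g) = \<iota> f \<bullet> g"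
    and C_bounded: "bounded_linear C"
    and C_selfadj: "C x \<bullet> y = x \<bullet> C y"
    and C_definite: "C x \<bullet> x = 0 \<Longrightarrow> C x = 0"
    and S_bounded: "bounded_linear S"
    and S_sqrt: "\<rho> \<ge> 0 \<Longrightarrow> \<iota> (adj x) = \<rho> *\<^sub>R x \<Longrightarrow> S x = sqrt \<rho> *\<^sub>R x"
    and z_orth: "z j \<bullet> z k = (if j = k then 1 else 0)"
    and z_eigen: "S (C (S (z k))) = \<nu> k *\<^sub>R z k"
    and \<nu>_pos: "\<nu> k > 0"
    and complete: "\<lbrakk>S (C (S x)) = c *\<^sub>R x; \<And>k. x \<bullet> z k = 0\<rbrakk> \<Longrightarrow> S x = 0"
begin

sublocale iota: bounded_linear \<iota>
  by (rule compact_operator_bounded_linear[OF compact_embedding])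

sublocale S: bounded_linear S
  by (rule S_bounded)

sublocale C: bounded_linear C
  by (rule C_bounded)

lemma form_eqI:
  assumes "\<And>f. B f g = B f h"
  shows "g = h"
proof -
  have "B (g - h) (g - h) = 0"
    using assms by (simp add: diff_right)
  then show ?thesis using form_eq_zero[of "g - h"] by simp
qed

text \<open>Coercivity at \<open>adj g\<close> bounds \<open>norm (adj g)\<close> squared by a
  multiple of \<open>norm (adj g) * norm g\<close>, and one factor cancels. Linearity comes from
  nondegeneracy of \<open>B\<close>.\<close>

lemma adj_bounded: "bounded_linear adj"
proof -
  obtain K where K: "\<And>y. norm (\<iota> y) \<le> norm y * K" "K \<ge> 0"
    using iota.nonneg_bounded by blast
  have "norm (adj g) \<le> norm g * (K / \<alpha>)" for g
  proof (cases "adj g = 0")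
    case False
    have "\<alpha> * (norm (adj g))\<^sup>2 \<le> \<iota> (adj g) \<bullet> g"
      using coercive[of "adj g"] by (simp add: adj)
    also have "\<dots> \<le> norm (\<iota> (adj g)) * norm g"
      by (rule norm_cauchy_schwarz)
    also have "\<dots> \<le> norm (adj g) * K * norm g"
      using K by (intro mult_right_mono) auto
    finally have "norm (adj g) * (\<alpha> * norm (adj g)) \<le> norm (adj g) * (K * norm g)"
      by (simp add: power2_eq_square algebra_simps)
    then have "\<alpha> * norm (adj g) \<le> K * norm g"
      using False by simp
    then show ?thesis
      using alpha_pos by (simp add: field_simps)
  qed (use K alpha_pos in simp)
  then show ?thesis
    by (intro bounded_linear_intro[where K = "K / \<alpha>"] form_eqI)
      (simp_all add: adj add_right scaleR_right inner_add_right)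
qed

sublocale adj: bounded_linear adj
  by (rule adj_bounded)

lemma SS: "S (S x) = \<iota> (adj x)" and S_selfadj: "S x \<bullet> y = x \<bullet> S y"
proof -
  have "compact_operator (\<lambda>x. \<iota> (adj x))"
    by (rule compact_operator_compose_right[OF compact_embedding adj_bounded])
  moreover have "\<iota> (adj x) \<bullet> y = x \<bullet> \<iota> (adj y)" for x y
    using adj[of "adj x" y] adj[of "adj y" x] by (simp add: sym[of "adj x"] inner_commute)
  moreover have "\<iota> (adj x) \<bullet> x \<ge> 0" for x
    using form_nonneg[of "adj x"] by (simp add: adj)
  ultimately show "S (S x) = \<iota> (adj x)" and "S x \<bullet> y = x \<bullet> S y"
    using sqrt_of_psd_compact[of "\<lambda>x. \<iota> (adj x)" S] S_bounded S_sqrt by blast+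
qed

text \<open>The square of \<open>norm (S x)\<close> is \<open>S (S x) \<bullet> x\<close>, so on
  bounded sequences convergence of the images under the compact \<open>S S\<close> makes the images
  under \<open>S\<close> Cauchy.\<close>

lemma compact_S: "compact_operator S"
proof (rule compact_operatorI)
  fix x :: "nat \<Rightarrow> 'l" and b assume x: "\<And>n. norm (x n) \<le> b"
  have "compact_operator (\<lambda>x. S (S x))"
    unfolding SS by (rule compact_operator_compose_right[OF compact_embedding adj_bounded])
  then obtain r l where r: "strict_mono r" "(\<lambda>n. S (S (x (r n)))) \<longlonglongrightarrow> l"
    using compact_operatorD[of "\<lambda>x. S (S x)" x b] x by blast
  have b: "b \<ge> 0" using x[of 0] norm_ge_zero order_trans by blast
  have *: "(norm (S (x i) - S (x j)))\<^sup>2 \<le> norm (S (S (x i)) - S (S (x j))) * (2 * b)" for i j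
  proof -
    have "(norm (S (x i) - S (x j)))\<^sup>2 = (S (S (x i)) - S (S (x j))) \<bullet> (x i - x j)"
      unfolding power2_norm_eq_inner by (simp add: S.diff[symmetric] S_selfadj)
    also have "\<dots> \<le> norm (S (S (x i)) - S (S (x j))) * norm (x i - x j)"
      by (rule norm_cauchy_schwarz)
    also have "norm (x i - x j) \<le> 2 * b"
      using norm_triangle_ineq4[of "x i" "x j"] x[of i] x[of j] by linarith
    finally show ?thesis by (simp add: mult_left_mono)
  qed
  have "Cauchy (\<lambda>n. S (x (r n)))"
  proof (rule CauchyI)
    fix e :: real assume "e > 0"
    define d where "d = e\<^sup>2 / (2 * b + 1)"
    have "d > 0" unfolding d_def using \<open>e > 0\<close> b by simp
    then obtain M where M: "\<And>m n. m \<ge> M \<Longrightarrow> n \<ge> M \<Longrightarrow> norm (S (S (x (r m))) - S (S (x (r n)))) < d"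
      using CauchyD[OF LIMSEQ_imp_Cauchy[OF r(2)]] by blast
    have "norm (S (x (r m)) - S (x (r n))) < e" if "m \<ge> M" "n \<ge> M" for m n
    proof -
      have "norm (S (S (x (r m))) - S (S (x (r n)))) * (2 * b) \<le> d * (2 * b)"
        using M[OF that] b by (intro mult_right_mono) auto
      also have "\<dots> < d * (2 * b + 1)" using \<open>d > 0\<close> by simp
      also have "\<dots> = e\<^sup>2" unfolding d_def using b by simp
      finally have "(norm (S (x (r m)) - S (x (r n))))\<^sup>2 < e\<^sup>2"
        using *[of "r m" "r n"] by linarith
      then show ?thesis using \<open>e > 0\<close> by (simp add: power2_less_imp_less)
    qed
    then show "\<exists>M. \<forall>m\<ge>M. \<forall>n\<ge>M. norm (S (x (r m)) - S (x (r n))) < e" by blast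
  qed
  then show "\<exists>r l. strict_mono r \<and> (\<lambda>n. S (x (r n))) \<longlonglongrightarrow> l"
    using r(1) Cauchy_convergent unfolding convergent_def by blast
qed (rule S_bounded)

text \<open>
  Density of the range of \<open>adj\<close> suffices, since \<open>S g \<mapsto> adj g\<close> is isometric into the form norm.
\<close>

lemma embedding_range_S: "\<exists>x. \<iota> f = S x"
proof -
  have "subspace (range adj)"
    by (rule linear_subspace_image[OF adj.linear subspace_UNIV])
  moreover have "x = 0" if "\<And>v. v \<in> range adj \<Longrightarrow> B x v = 0" for x
  proof -
    have "\<iota> x \<bullet> \<iota> x = 0" using that[of "adj (\<iota> x)"] by (simp add: adj)
    then show ?thesis by (simp add: embedding_inj)
  qed
  ultimately have "f \<in> closure (range adj)"
    using dense_subspace by blast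
  then obtain h where h: "\<forall>n. h n \<in> range adj" "h \<longlonglongrightarrow> f"
    using closure_sequential[of f "range adj"] by auto
  then have "\<forall>n. \<exists>g. h n = adj g" by blast
  then obtain g where g: "\<And>n. h n = adj (g n)" by metis
  obtain K where K: "\<And>a b. norm (B a b) \<le> norm a * norm b * K" "K \<ge> 0"
    using nonneg_bounded by blast
  \<comment> \<open>\<open>S S = \<iota> adj\<close> turns the squared norm of \<open>S g\<close>
    into \<open>B (adj g) (adj g)\<close>. Hence \<open>S (g n)\<close> is Cauchy although
    \<open>g n\<close> need not converge.\<close>
  have iso: "(norm (S (g m) - S (g n)))\<^sup>2 \<le> K * (norm (h m - h n))\<^sup>2" for m n
  proof -
    have "(norm (S (g m) - S (g n)))\<^sup>2 = S (S (g m - g n)) \<bullet> (g m - g n)"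
      unfolding power2_norm_eq_inner by (simp add: S.diff[symmetric] S_selfadj)
    also have "\<dots> = B (h m - h n) (h m - h n)"
      by (simp add: SS g adj.diff[symmetric] adj)
    also have "\<dots> \<le> norm (B (h m - h n) (h m - h n))" by simp
    also have "\<dots> \<le> norm (h m - h n) * norm (h m - h n) * K" by (rule K)
    finally show ?thesis by (simp add: power2_eq_square mult.commute)
  qed
  have "Cauchy (\<lambda>n. S (g n))"
  proof (rule CauchyI)
    fix e :: real assume "e > 0"
    define d where "d = e / sqrt (K + 1)"
    have "d > 0" unfolding d_def using \<open>e > 0\<close> K by simp
    then obtain M where M: "\<And>m n. m \<ge> M \<Longrightarrow> n \<ge> M \<Longrightarrow> norm (h m - h n) < d"
      using CauchyD[OF LIMSEQ_imp_Cauchy[OF h(2)]] by blast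
    have "norm (S (g m) - S (g n)) < e" if "m \<ge> M" "n \<ge> M" for m n
    proof -
      have "(norm (h m - h n))\<^sup>2 \<le> d\<^sup>2"
        using M[OF that] by (intro power_mono) auto
      then have "K * (norm (h m - h n))\<^sup>2 \<le> K * d\<^sup>2"
        using K(2) by (rule mult_left_mono)
      also have "\<dots> < (K + 1) * d\<^sup>2" using \<open>d > 0\<close> by simp
      also have "\<dots> = e\<^sup>2" unfolding d_def using K(2) by (simp add: power_divide)
      finally have "(norm (S (g m) - S (g n)))\<^sup>2 < e\<^sup>2"
        using iso[of m n] by linarith
      then show ?thesis using \<open>e > 0\<close> by (simp add: power2_less_imp_less)
    qed
    then show "\<exists>M. \<forall>m\<ge>M. \<forall>n\<ge>M. norm (S (g m) - S (g n)) < e" by blast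
  qed
  then obtain x where x: "(\<lambda>n. S (g n)) \<longlonglongrightarrow> x"
    using Cauchy_convergent convergent_def by blast
  have "(\<lambda>n. \<iota> (h n)) \<longlonglongrightarrow> S x"
    using S.tendsto[OF x] by (simp add: SS g)
  then have "\<iota> f = S x"
    using LIMSEQ_unique iota.tendsto[OF h(2)] by blast
  then show ?thesis by blast
qed

text \<open>The eigenvalue equation gives
  \<open>S (z k) = (1 / \<nu> k) *\<^sub>R S (S (C (S (z k))))\<close>, and \<open>S S\<close>
  factors through \<open>adj\<close>; this is the explicit preimage of \<open>S (z k)\<close> under
  \<open>\<iota>\<close>.\<close>

definition u :: "nat \<Rightarrow> 'h" where
  "u k = (1 / \<nu> k) *\<^sub>R adj (C (S (z k)))"

lemma embedding_u: "\<iota> (u k) = S (z k)"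
proof -
  have "\<iota> (u k) = (1 / \<nu> k) *\<^sub>R S (S (C (S (z k))))"
    unfolding u_def SS by (simp add: iota.scaleR)
  then show ?thesis
    using \<nu>_pos[of k] by (simp add: z_eigen S.scaleR)
qed

lemma form_u: "B f (u k) = (\<iota> f \<bullet> C (S (z k))) / \<nu> k"
  unfolding u_def by (simp add: scaleR_right adj)

lemma u_orth: "B (u j) (u k) = (if j = k then 1 else 0)"
  using \<nu>_pos[of k] by (simp add: form_u embedding_u S_selfadj z_eigen z_orth)

text \<open>\<open>complete\<close> speaks of eigenvectors, not of arbitrary vectors orthogonal to
  all \<open>z k\<close>. The eigenvector theorem on their orthogonal complement closes this gap:
  \<open>S C S\<close> vanishes there, and what it annihilates is an eigenvector for 0.\<close>

lemma u_total:
  assumes "\<And>k. B f (u k) = 0"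
  shows "f = 0"
proof -
  have compact: "compact_operator (\<lambda>x. S (C (S x)))"
    by (rule compact_operator_compose_right[OF compact_S bounded_linear_compose[OF C_bounded S_bounded]])
  have selfadj: "S (C (S x)) \<bullet> y = x \<bullet> S (C (S y))" for x y
    by (simp add: S_selfadj C_selfadj)
  \<comment> \<open>By \<open>form_u\<close>, vanishing of \<open>B f (u k)\<close> means that
    \<open>C (\<iota> f)\<close> is orthogonal to \<open>S (z k)\<close>, that is, \<open>x\<close>
    is orthogonal to \<open>z k\<close>.\<close>
  define x where "x = S (C (\<iota> f))"
  define V where "V = {y. \<forall>k. y \<bullet> z k = 0}"
  have "x \<bullet> z k = 0" for k
    using assms[of k] \<nu>_pos[of k] unfolding x_def by (simp add: form_u S_selfadj C_selfadj)
  then have "x \<in> V" unfolding V_def by blast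
  have "S (C (S x)) = 0"
  proof (rule ccontr)
    assume "S (C (S x)) \<noteq> 0"
    moreover have "subspace V"
      unfolding V_def subspace_def by (auto simp: inner_add_left)
    moreover have "closed V"
      unfolding V_def by (intro closed_Collect_all closed_Collect_eq continuous_intros)
    moreover have "S (C (S y)) \<in> V" if "y \<in> V" for y
      using that unfolding V_def by (simp add: selfadj z_eigen)
    ultimately obtain c g where g: "g \<in> V" "g \<noteq> 0" "c \<noteq> 0" "S (C (S g)) = c *\<^sub>R g"
      using compact_selfadjoint_eigenvector[OF compact selfadj, of V x] \<open>x \<in> V\<close> by blast
    then have "S g = 0"
      using complete[of g c] unfolding V_def by blast
    then show False
      using g by (simp add: C.zero S.zero)
  qed
  then have "S x = 0"
    using complete[of x 0] \<open>x \<in> V\<close> unfolding V_def by simp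
  \<comment> \<open>The factors are peeled off one by one: \<open>\<iota>\<close> by injectivity,
    \<open>adj\<close> by testing with \<open>f\<close>, and the quadratic form by
    \<open>C_definite\<close>.\<close>
  then have "\<iota> (adj (C (\<iota> f))) = 0"
    unfolding x_def by (simp add: SS)
  then have "adj (C (\<iota> f)) = 0"
    by (rule embedding_inj)
  then have "\<iota> f \<bullet> C (\<iota> f) = 0"
    using adj[of f "C (\<iota> f)"] by (simp add: zero_right)
  then have "C (\<iota> f) = 0"
    using C_definite by (simp add: inner_commute)
  moreover obtain y where y: "\<iota> f = S y"
    using embedding_range_S by blast
  ultimately have "S (C (S y)) = 0"
    by (simp add: S.zero)
  \<comment> \<open>eigenvectors to the distinct eigenvalues \<open>0\<close> and \<open>\<nu> k\<close> are orthogonal\<close>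
  moreover have "y \<bullet> z k = 0" for k
    using selfadj[of y "z k"] calculation \<nu>_pos[of k] by (simp add: z_eigen)
  ultimately have "S y = 0"
    using complete[of y 0] by simp
  then show ?thesis
    using y embedding_inj by simp
qed

lemma expansion: "(\<lambda>k. B f (u k) *\<^sub>R u k) sums f"
  by (rule orthonormal_expansion[OF u_orth u_total])

lemma Parseval: "(\<lambda>k. (B f (u k))\<^sup>2) sums B f f"
  using bounded_linear.sums[OF bounded_linear_right expansion[of f], of f]
  by (simp add: scaleR_right power2_eq_square)

text \<open>Only one argument is expanded; self-adjointness of \<open>C\<close> and
  \<open>form_u\<close> evaluate the pairing of the other one with \<open>S (z k)\<close> as
  \<open>\<nu> k * B f (u k)\<close>.\<close>

lemma C_Parseval: "(\<lambda>k. \<nu> k * (B f (u k))\<^sup>2) sums (C (\<iota> f) \<bullet> \<iota> f)"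
proof -
  have "(\<lambda>k. C (\<iota> f) \<bullet> \<iota> (B f (u k) *\<^sub>R u k)) sums (C (\<iota> f) \<bullet> \<iota> f)"
    by (rule bounded_linear.sums[OF _ expansion])
      (rule bounded_linear_compose[OF bounded_linear_inner_right iota.bounded_linear_axioms])
  moreover have "C (\<iota> f) \<bullet> \<iota> (B f (u k) *\<^sub>R u k) = \<nu> k * (B f (u k))\<^sup>2" for k
    using \<nu>_pos[of k]
    by (simp add: iota.scaleR embedding_u C_selfadj form_u power2_eq_square)
  ultimately show ?thesis by simp
qed

end

subsection \<open>Square-integrable functions as a Hilbert space\<close>

lemma L2_measurable [measurable_dest]: "f \<in> L2 T \<Longrightarrow> f \<in> borel_measurable (lebesgue_on T)"
  by (simp add: L2_def)

lemma L2_square_integrable: "f \<in> L2 T \<Longrightarrow> integrable (lebesgue_on T) (\<lambda>t. (f t)\<^sup>2)"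
  by (simp add: L2_def)

lemma L2I:
  assumes "f \<in> borel_measurable (lebesgue_on T)" and "integrable (lebesgue_on T) (\<lambda>t. (f t)\<^sup>2)"
  shows "f \<in> L2 T"
  using assms by (simp add: L2_def)

lemma L2_mult_integrable:
  assumes "f \<in> L2 T" and "g \<in> L2 T"
  shows "integrable (lebesgue_on T) (\<lambda>t. f t * g t)"
proof (rule Bochner_Integration.integrable_bound)
  show "integrable (lebesgue_on T) (\<lambda>t. (f t)\<^sup>2 + (g t)\<^sup>2)"
    using assms by (intro Bochner_Integration.integrable_add L2_square_integrable)
  show "AE t in lebesgue_on T. norm (f t * g t) \<le> norm ((f t)\<^sup>2 + (g t)\<^sup>2)"
  proof (rule AE_I2)
    fix t
    have "2 * \<bar>f t * g t\<bar> \<le> (f t)\<^sup>2 + (g t)\<^sup>2"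
      using sum_squares_bound[of "\<bar>f t\<bar>" "\<bar>g t\<bar>"] by (simp add: abs_mult)
    then show "norm (f t * g t) \<le> norm ((f t)\<^sup>2 + (g t)\<^sup>2)"
      by simp
  qed
qed (use assms in measurable)

lemma L2_lincomb:
  assumes f: "f \<in> L2 T" and g: "g \<in> L2 T"
  shows "(\<lambda>t. a * f t + b * g t) \<in> L2 T"
proof (rule L2I)
  show "(\<lambda>t. a * f t + b * g t) \<in> borel_measurable (lebesgue_on T)"
    using assms by measurable
  have "integrable (lebesgue_on T) (\<lambda>t. a\<^sup>2 * (f t)\<^sup>2 + 2 * a * b * (f t * g t) + b\<^sup>2 * (g t)\<^sup>2)"
    using assms by (intro Bochner_Integration.integrable_add integrable_mult_right
        L2_square_integrable L2_mult_integrable)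
  then show "integrable (lebesgue_on T) (\<lambda>t. (a * f t + b * g t)\<^sup>2)"
    by (simp add: power2_eq_square algebra_simps)
qed

lemma L2_add: "f \<in> L2 T \<Longrightarrow> g \<in> L2 T \<Longrightarrow> (\<lambda>t. f t + g t) \<in> L2 T"
  using L2_lincomb[of f T g 1 1] by simp

lemma L2_scale: "f \<in> L2 T \<Longrightarrow> (\<lambda>t. a * f t) \<in> L2 T"
  using L2_lincomb[of f T f a 0] by simp

lemma L2_diff: "f \<in> L2 T \<Longrightarrow> g \<in> L2 T \<Longrightarrow> (\<lambda>t. f t - g t) \<in> L2 T"
  using L2_lincomb[of f T g 1 "-1"] by simp

lemma L2_zero: "(\<lambda>t. 0) \<in> L2 T"
  by (rule L2I) auto

lemma eq_L2_refl: "eq_L2 T f f"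
  by (simp add: eq_L2_def)

lemma eq_L2_sym: "eq_L2 T f g \<Longrightarrow> eq_L2 T g f"
  unfolding eq_L2_def by auto

lemma eq_L2_trans: "eq_L2 T f g \<Longrightarrow> eq_L2 T g h \<Longrightarrow> eq_L2 T f h"
  unfolding eq_L2_def by auto

lemma eq_L2_lincomb:
  "eq_L2 T f f' \<Longrightarrow> eq_L2 T g g' \<Longrightarrow>
    eq_L2 T (\<lambda>t. a * f t + b * g t) (\<lambda>t. a * f' t + b * g' t)"
  unfolding eq_L2_def by auto

lemma inner_L2_cong:
  assumes "f \<in> L2 T" "f' \<in> L2 T" "g \<in> L2 T" "g' \<in> L2 T" "eq_L2 T f f'" "eq_L2 T g g'"
  shows "inner_L2 T f g = inner_L2 T f' g'"
  unfolding inner_L2_def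
proof (rule integral_cong_AE)
  show "AE t in lebesgue_on T. f t * g t = f' t * g' t"
    using assms(5,6) unfolding eq_L2_def by eventually_elim simp
qed (use assms(1-4) in measurable)

lemma inner_L2_self_eq_zero:
  assumes "f \<in> L2 T" and "inner_L2 T f f = 0"
  shows "eq_L2 T f (\<lambda>t. 0)"
proof -
  have "AE t in lebesgue_on T. (f t)\<^sup>2 = 0"
    using assms integral_nonneg_eq_0_iff_AE[OF L2_square_integrable[OF assms(1)]]
    unfolding inner_L2_def by (simp add: power2_eq_square)
  then show ?thesis unfolding eq_L2_def by simp
qed

\<comment> \<open>Partial, so that every representative \<open>rep_l2 x\<close> is square integrable
  and can be fed to operators defined on functions.\<close>
quotient_type (overloaded) 'a l2 = "'a::euclidean_space \<Rightarrow> real" /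
  partial: "\<lambda>f g. f \<in> L2 UNIV \<and> g \<in> L2 UNIV \<and> eq_L2 UNIV f g"
proof (rule part_equivpI)
  show "\<exists>f::'a \<Rightarrow> real. f \<in> L2 UNIV \<and> f \<in> L2 UNIV \<and> eq_L2 UNIV f f"
    using L2_zero eq_L2_refl by blast
qed (auto intro!: sympI transpI intro: eq_L2_sym eq_L2_trans)

instantiation l2 :: (euclidean_space) real_inner
begin

lift_definition zero_l2 :: "'a l2" is "\<lambda>_. 0"
  by (simp add: L2_zero eq_L2_refl)

lift_definition plus_l2 :: "'a l2 \<Rightarrow> 'a l2 \<Rightarrow> 'a l2" is "\<lambda>f g t. f t + g t"
  using eq_L2_lincomb[of UNIV _ _ _ _ 1 1] by (auto intro: L2_add)

lift_definition minus_l2 :: "'a l2 \<Rightarrow> 'a l2 \<Rightarrow> 'a l2" is "\<lambda>f g t. f t - g t"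
  using eq_L2_lincomb[of UNIV _ _ _ _ 1 "-1"] by (auto intro: L2_diff)

lift_definition uminus_l2 :: "'a l2 \<Rightarrow> 'a l2" is "\<lambda>f t. - f t"
  using eq_L2_lincomb[of UNIV _ _ _ _ "-1" 0] L2_scale[of _ UNIV "-1"] by auto

lift_definition scaleR_l2 :: "real \<Rightarrow> 'a l2 \<Rightarrow> 'a l2" is "\<lambda>c f t. c * f t"
  using eq_L2_lincomb[of UNIV _ _ _ _ _ 0] by (auto intro: L2_scale)

lift_definition inner_l2 :: "'a l2 \<Rightarrow> 'a l2 \<Rightarrow> real" is "inner_L2 UNIV"
  by (blast intro: inner_L2_cong)

definition norm_l2 :: "'a l2 \<Rightarrow> real" where "norm_l2 x = sqrt (inner x x)"

definition dist_l2 :: "'a l2 \<Rightarrow> 'a l2 \<Rightarrow> real" where "dist_l2 x y = norm (x - y)"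

definition sgn_l2 :: "'a l2 \<Rightarrow> 'a l2" where "sgn_l2 x = inverse (norm x) *\<^sub>R x"

definition uniformity_l2 :: "('a l2 \<times> 'a l2) filter" where
  "uniformity_l2 = (INF e\<in>{0 <..}. principal {(x, y). dist x y < e})"

definition open_l2 :: "'a l2 set \<Rightarrow> bool" where
  "open_l2 U = (\<forall>x\<in>U. \<forall>\<^sub>F (x', y) in uniformity. x' = x \<longrightarrow> y \<in> U)"

instance
proof
  fix x y z :: "'a l2" and a b r :: real
  show "x + y + z = x + (y + z)"
    by transfer (simp add: L2_add eq_L2_refl add.assoc)
  show "x + y = y + x"
    by transfer (simp add: L2_add eq_L2_refl add.commute)
  show "0 + x = x"
    by transfer (simp add: eq_L2_refl)
  show "- x + x = 0"
    by transfer (simp add: eq_L2_refl L2_zero)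
  show "x - y = x + - y"
    by transfer (simp add: eq_L2_refl L2_diff)
  show "a *\<^sub>R (x + y) = a *\<^sub>R x + a *\<^sub>R y"
    by transfer (simp add: eq_L2_refl L2_scale L2_add distrib_left)
  show "(a + b) *\<^sub>R x = a *\<^sub>R x + b *\<^sub>R x"
    by transfer (simp add: eq_L2_refl L2_scale L2_lincomb distrib_right)
  show "a *\<^sub>R b *\<^sub>R x = (a * b) *\<^sub>R x"
    by transfer (simp add: eq_L2_refl L2_scale mult.assoc)
  show "1 *\<^sub>R x = x"
    by transfer (simp add: eq_L2_refl)
  show "inner x y = inner y x"
    by transfer (simp add: inner_L2_def mult.commute)
  show "inner (x + y) z = inner x z + inner y z"
    by transfer (simp add: inner_L2_def distrib_right L2_mult_integrable)
  show "inner (r *\<^sub>R x) y = r * inner x y"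
    by transfer (simp add: inner_L2_def mult.assoc)
  show "0 \<le> inner x x"
    by transfer (simp add: inner_L2_def)
  show "inner x x = 0 \<longleftrightarrow> x = 0"
  proof
    assume "inner x x = 0"
    then show "x = 0"
      by transfer (simp add: L2_zero inner_L2_self_eq_zero)
  next
    assume "x = 0"
    then show "inner x x = 0"
      by simp (transfer, simp add: inner_L2_def)
  qed
qed (simp_all add: dist_l2_def norm_l2_def sgn_l2_def uniformity_l2_def open_l2_def)

end

lemma Cauchy_fast_subseq:
  fixes X :: "nat \<Rightarrow> 'a::metric_space"
  assumes "Cauchy X" and "\<And>n. e n > 0"
  shows "\<exists>r. strict_mono r \<and> (\<forall>n. dist (X (r (Suc n))) (X (r n)) < e n)"
proof -
  have "\<exists>N. \<forall>m\<ge>N. \<forall>k\<ge>N. dist (X m) (X k) < e n" for n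
    using assms unfolding Cauchy_def by blast
  then obtain N where N: "\<And>n m k. m \<ge> N n \<Longrightarrow> k \<ge> N n \<Longrightarrow> dist (X m) (X k) < e n"
    by metis
  \<comment> \<open>Summing \<open>Suc (N i)\<close> makes \<open>r\<close> strictly increasing and
    at least \<open>N n\<close> at the same time.\<close>
  define r where "r n = (\<Sum>i\<le>n. Suc (N i))" for n
  have "strict_mono r"
    unfolding strict_mono_Suc_iff r_def by simp
  moreover have "r n \<ge> N n" for n
    unfolding r_def by (cases n) auto
  then have "dist (X (r (Suc n))) (X (r n)) < e n" for n
    using N[of n "r (Suc n)" "r n"] strict_mono_leD[OF \<open>strict_mono r\<close>, of n "Suc n"]
    by (meson lessI less_imp_le_nat order_trans)
  ultimately show ?thesis by blast
qed

text \<open>The weighted squares are bounded, and under the square root the weight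
  \<open>4 ^ i\<close> becomes geometric decay \<open>(1 / 2) ^ i\<close> of the increments.\<close>

lemma convergent_of_weighted_square_summable:
  fixes f :: "nat \<Rightarrow> real"
  assumes "summable (\<lambda>i. 4 ^ i * (f (Suc i) - f i)\<^sup>2)"
  shows "convergent f"
proof -
  have "Bseq (\<lambda>i. 4 ^ i * (f (Suc i) - f i)\<^sup>2)"
    using summable_LIMSEQ_zero[OF assms] by (intro convergent_imp_Bseq) (auto simp: convergent_def)
  then obtain c where c: "c > 0" "\<And>i. norm (4 ^ i * (f (Suc i) - f i)\<^sup>2) \<le> c"
    unfolding Bseq_def by blast
  have "norm (f (Suc i) - f i) \<le> sqrt c * (1 / 2) ^ i" for i
  proof (rule power2_le_imp_le)
    have "(f (Suc i) - f i)\<^sup>2 \<le> c / 4 ^ i"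
      using c(2)[of i] by (simp add: field_simps)
    also have "\<dots> = (sqrt c * (1 / 2) ^ i)\<^sup>2"
      using c(1) power_mult_distrib[of "2::real" 2 i]
      by (simp add: power_mult_distrib power_one_over power2_eq_square field_simps)
    finally show "(norm (f (Suc i) - f i))\<^sup>2 \<le> (sqrt c * (1 / 2) ^ i)\<^sup>2" by simp
  qed (use c in simp)
  then have "summable (\<lambda>i. f (Suc i) - f i)"
    by (rule summable_comparison_test'[of "\<lambda>i. sqrt c * (1 / 2) ^ i" 0, rotated])
      (simp add: summable_mult)
  then have "convergent (\<lambda>n. \<Sum>i<n. f (Suc i) - f i)"
    by (simp add: summable_iff_convergent)
  then have "convergent (\<lambda>n. (f n - f 0) + f 0)"
    by (intro convergent_add convergent_const) (simp add: sum_lessThan_telescope)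
  then show ?thesis by simp
qed

lemma rep_l2_L2: "rep_l2 x \<in> L2 UNIV"
  using Quotient_rep_reflp[OF Quotient_l2] by blast

lemma abs_rep_l2: "abs_l2 (rep_l2 x) = x"
  using Quotient_abs_rep[OF Quotient_l2] .

lemma abs_l2_eq_iff: "f \<in> L2 UNIV \<Longrightarrow> g \<in> L2 UNIV \<Longrightarrow> abs_l2 f = abs_l2 g \<longleftrightarrow> eq_L2 UNIV f g"
  using Quotient_rel[OF Quotient_l2] eq_L2_refl by blast

lemma rep_abs_l2: "f \<in> L2 UNIV \<Longrightarrow> eq_L2 UNIV (rep_l2 (abs_l2 f)) f"
  using abs_l2_eq_iff[of "rep_l2 (abs_l2 f)" f] by (simp add: rep_l2_L2 abs_rep_l2)

lemma abs_l2_lincomb: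
  assumes "f \<in> L2 UNIV" and "g \<in> L2 UNIV"
  shows "abs_l2 (\<lambda>t. a * f t + b * g t) = a *\<^sub>R abs_l2 f + b *\<^sub>R abs_l2 g"
  using assms by (simp add: scaleR_l2.abs_eq plus_l2.abs_eq eq_L2_refl L2_scale)

lemma abs_l2_diff:
  "f \<in> L2 UNIV \<Longrightarrow> g \<in> L2 UNIV \<Longrightarrow> abs_l2 (\<lambda>t. f t - g t) = abs_l2 f - abs_l2 g"
  by (simp add: minus_l2.abs_eq eq_L2_refl)

lemma inner_abs_l2:
  "f \<in> L2 UNIV \<Longrightarrow> g \<in> L2 UNIV \<Longrightarrow> inner (abs_l2 f) (abs_l2 g) = inner_L2 UNIV f g"
  by (simp add: inner_l2.abs_eq eq_L2_refl)

lemma inner_L2_self: "inner_L2 T f f = (LINT t|lebesgue_on T. (f t)\<^sup>2)"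
  by (simp add: inner_L2_def power2_eq_square)

lemma norm_abs_l2: "f \<in> L2 UNIV \<Longrightarrow> (norm (abs_l2 f))\<^sup>2 = (LINT t|lebesgue_on UNIV. (f t)\<^sup>2)"
  by (simp add: power2_norm_eq_inner inner_abs_l2 inner_L2_self)

lemma nn_integral_square:
  "f \<in> L2 T \<Longrightarrow> (\<integral>\<^sup>+t. ennreal ((f t)\<^sup>2) \<partial>lebesgue_on T) = ennreal (LINT t|lebesgue_on T. (f t)\<^sup>2)"
  by (rule nn_integral_eq_integral) (auto simp: L2_square_integrable)

text \<open>
  Riesz-Fischer: with \<open>\<parallel>f (Suc n) - f n\<parallel>\<^sup>2 < 16 powi (- n)\<close> the series of \<open>4 ^ n * (f (Suc n) - f n)\<^sup>2\<close>
  is integrable, hence finite almost everywhere.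
\<close>

instance l2 :: (euclidean_space) complete_space
proof
  fix X :: "nat \<Rightarrow> 'a l2"
  assume "Cauchy X"
  then obtain r where r: "strict_mono r" "\<And>n. dist (X (r (Suc n))) (X (r n)) < (1 / 4) ^ n"
    using Cauchy_fast_subseq[of X "\<lambda>n. (1 / 4) ^ n"] by auto
  let ?M = "lebesgue_on (UNIV :: 'a set)"
  define f where "f n = rep_l2 (X (r n))" for n
  have f: "f n \<in> L2 UNIV" "abs_l2 (f n) = X (r n)" for n
    unfolding f_def by (simp_all add: rep_l2_L2 abs_rep_l2)
  have [measurable]: "f n \<in> borel_measurable ?M" for n
    by (rule L2_measurable[OF f(1)])
  have dist_f: "(\<integral>\<^sup>+t. ennreal ((f m t - f n t)\<^sup>2) \<partial>?M) = ennreal ((dist (X (r m)) (X (r n)))\<^sup>2)" for m n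
    using f by (simp add: nn_integral_square L2_diff norm_abs_l2[symmetric] abs_l2_diff dist_norm)
  have "(\<integral>\<^sup>+t. (\<Sum>i. ennreal (4 ^ i * (f (Suc i) t - f i t)\<^sup>2)) \<partial>?M) =
      (\<Sum>i. \<integral>\<^sup>+t. ennreal (4 ^ i * (f (Suc i) t - f i t)\<^sup>2) \<partial>?M)"
    by (rule nn_integral_suminf) measurable
  also have "\<dots> \<le> (\<Sum>i. ennreal ((1 / 4) ^ i))"
  proof (intro suminf_le summableI)
    fix i
    have "(\<integral>\<^sup>+t. ennreal (4 ^ i * (f (Suc i) t - f i t)\<^sup>2) \<partial>?M) =
        ennreal (4 ^ i) * ennreal ((dist (X (r (Suc i))) (X (r i)))\<^sup>2)"
      unfolding dist_f[symmetric] by (subst nn_integral_cmult[symmetric]) (auto simp: ennreal_mult)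
    also have "\<dots> = ennreal (4 ^ i * (dist (X (r (Suc i))) (X (r i)))\<^sup>2)"
      by (simp add: ennreal_mult)
    also have "\<dots> \<le> ennreal (4 ^ i * ((1 / 4) ^ i)\<^sup>2)"
      using r(2)[of i] by (intro ennreal_leI mult_left_mono power_mono) auto
    also have "4 ^ i * ((1 / 4) ^ i)\<^sup>2 = ((1 / 4) ^ i :: real)"
      by (simp add: power2_eq_square power_one_over)
    finally show "(\<integral>\<^sup>+t. ennreal (4 ^ i * (f (Suc i) t - f i t)\<^sup>2) \<partial>?M) \<le> ennreal ((1 / 4) ^ i)" .
  qed
  also have "\<dots> < \<infinity>"
    by (simp add: suminf_ennreal2 summable_geometric)
  finally have "AE t in ?M. (\<Sum>i. ennreal (4 ^ i * (f (Suc i) t - f i t)\<^sup>2)) \<noteq> \<infinity>"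
    by (intro nn_integral_PInf_AE) auto
  then have "AE t in ?M. convergent (\<lambda>n. f n t)"
  proof eventually_elim
    case (elim t)
    then have "summable (\<lambda>i. 4 ^ i * (f (Suc i) t - f i t)\<^sup>2)"
      by (intro summable_suminf_not_top) auto
    then show ?case by (rule convergent_of_weighted_square_summable)
  qed
  define g where "g t = lim (\<lambda>n. f n t)" for t
  have [measurable]: "g \<in> borel_measurable ?M"
    unfolding g_def by measurable
  have conv: "AE t in ?M. (\<lambda>n. f n t) \<longlonglongrightarrow> g t"
    using \<open>AE t in ?M. convergent (\<lambda>n. f n t)\<close> unfolding g_def
    by eventually_elim (simp add: convergent_LIMSEQ_iff)
  \<comment> \<open>Letting \<open>m\<close> tend to infinity under the integral carries the bound
    on \<open>f n - f m\<close> over to \<open>f n - g\<close>, before \<open>g\<close> is known to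
    be square integrable.\<close>
  have Fatou: "(\<integral>\<^sup>+t. ennreal ((f n t - g t)\<^sup>2) \<partial>?M) \<le> ennreal (e\<^sup>2)"
    if e: "\<And>m. m \<ge> N \<Longrightarrow> dist (X (r n)) (X (r m)) \<le> e" for n N e
  proof -
    have "(\<integral>\<^sup>+t. ennreal ((f n t - g t)\<^sup>2) \<partial>?M) = (\<integral>\<^sup>+t. liminf (\<lambda>m. ennreal ((f n t - f m t)\<^sup>2)) \<partial>?M)"
    proof (rule nn_integral_cong_AE)
      show "AE t in ?M. ennreal ((f n t - g t)\<^sup>2) = liminf (\<lambda>m. ennreal ((f n t - f m t)\<^sup>2))"
        using conv
      proof eventually_elim
        case (elim t)
        then have "(\<lambda>m. ennreal ((f n t - f m t)\<^sup>2)) \<longlonglongrightarrow> ennreal ((f n t - g t)\<^sup>2)"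
          by (intro tendsto_intros tendsto_ennrealI)
        then show ?case
          by (rule lim_imp_Liminf[OF sequentially_bot, symmetric])
      qed
    qed
    also have "\<dots> \<le> liminf (\<lambda>m. \<integral>\<^sup>+t. ennreal ((f n t - f m t)\<^sup>2) \<partial>?M)"
      by (rule nn_integral_liminf) measurable
    also have "\<dots> \<le> limsup (\<lambda>m. \<integral>\<^sup>+t. ennreal ((f n t - f m t)\<^sup>2) \<partial>?M)"
      by (rule Liminf_le_Limsup) simp
    also have "\<dots> \<le> ennreal (e\<^sup>2)"
      by (rule Limsup_bounded)
        (auto simp: dist_f eventually_sequentially intro!: exI[of _ N] ennreal_leI power_mono e)
    finally show ?thesis .
  qed
  have "Cauchy (\<lambda>n. X (r n))"
    using Cauchy_subseq_Cauchy[OF \<open>Cauchy X\<close> r(1)] by (simp add: o_def)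
  have diffL2: "(\<lambda>t. f n t - g t) \<in> L2 UNIV \<and> (LINT t|?M. (f n t - g t)\<^sup>2) \<le> e\<^sup>2"
    if e: "\<And>m. m \<ge> N \<Longrightarrow> dist (X (r n)) (X (r m)) \<le> e" for n N e
  proof
    have le: "(\<integral>\<^sup>+t. ennreal ((f n t - g t)\<^sup>2) \<partial>?M) \<le> ennreal (e\<^sup>2)"
      by (rule Fatou[of N]) (rule e)
    have "integrable ?M (\<lambda>t. (f n t - g t)\<^sup>2)"
      using le by (intro integrableI_nonneg) (auto intro: le_less_trans)
    then show L2: "(\<lambda>t. f n t - g t) \<in> L2 UNIV"
      by (intro L2I) measurable
    show "(LINT t|?M. (f n t - g t)\<^sup>2) \<le> e\<^sup>2"
      using le nn_integral_square[OF L2] by simp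
  qed
  have near: "\<exists>N. \<forall>n\<ge>N. \<forall>m\<ge>N. dist (X (r n)) (X (r m)) \<le> e" if "e > 0" for e
    using \<open>Cauchy (\<lambda>n. X (r n))\<close> that unfolding Cauchy_def by (meson less_imp_le)
  have gL2: "g \<in> L2 UNIV"
  proof -
    obtain N where "\<And>m. m \<ge> N \<Longrightarrow> dist (X (r N)) (X (r m)) \<le> 1"
      using near[of 1] by auto
    then have "(\<lambda>t. f N t - g t) \<in> L2 UNIV"
      using diffL2 by blast
    then have "(\<lambda>t. f N t - (f N t - g t)) \<in> L2 UNIV"
      using f(1) by (rule_tac L2_diff)
    then show ?thesis by simp
  qed
  have "(\<lambda>n. X (r n)) \<longlonglongrightarrow> abs_l2 g"
  proof (rule metric_LIMSEQ_I)
    fix e :: real assume "e > 0"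
    then obtain N where N: "\<And>n m. n \<ge> N \<Longrightarrow> m \<ge> N \<Longrightarrow> dist (X (r n)) (X (r m)) \<le> e / 2"
      using near[of "e / 2"] by auto
    have "dist (X (r n)) (abs_l2 g) < e" if "n \<ge> N" for n
    proof -
      have "(dist (X (r n)) (abs_l2 g))\<^sup>2 = (LINT t|?M. (f n t - g t)\<^sup>2)"
        using f gL2 by (simp add: dist_norm norm_abs_l2[symmetric] abs_l2_diff L2_diff)
      also have "\<dots> \<le> (e / 2)\<^sup>2"
        using diffL2[OF N[OF that]] by blast
      finally have "dist (X (r n)) (abs_l2 g) \<le> e / 2"
        by (rule power2_le_imp_le) (use \<open>e > 0\<close> in simp)
      then show ?thesis using \<open>e > 0\<close> by linarith
    qed
    then show "\<exists>N. \<forall>n\<ge>N. dist (X (r n)) (abs_l2 g) < e" by blast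
  qed
  then have "X \<longlonglongrightarrow> abs_l2 g"
    using Cauchy_converges_subseq[OF \<open>Cauchy X\<close> r(1)] by (simp add: o_def)
  then show "convergent X"
    unfolding convergent_def by blast
qed

text \<open>
  A type cannot depend on \<open>T\<close>, so L2(T) is embedded into the type \<open>l2\<close> over the whole space by
  extending functions by zero.
\<close>

definition embed_L2 :: "'a::euclidean_space set \<Rightarrow> ('a \<Rightarrow> real) \<Rightarrow> 'a l2" where
  "embed_L2 T f = abs_l2 (\<lambda>t. indicator T t * f t)"

text \<open>For \<open>A\<close> with \<open>bounded_linear_L2 T A\<close> the choice of
  representative does not matter, and the part of \<open>x\<close> off \<open>T\<close> is
  discarded.\<close>

definition lift_L2 ::
    "'a::euclidean_space set \<Rightarrow> (('a \<Rightarrow> real) \<Rightarrow> 'a \<Rightarrow> real) \<Rightarrow> 'a l2 \<Rightarrow> 'a l2" where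
  "lift_L2 T A x = embed_L2 T (A (rep_l2 x))"

lemma inner_L2_lincomb_left:
  assumes "f \<in> L2 T" "g \<in> L2 T" "h \<in> L2 T"
  shows "inner_L2 T (\<lambda>t. a * f t + b * g t) h = a * inner_L2 T f h + b * inner_L2 T g h"
proof -
  have "(LINT t|lebesgue_on T. (a * f t + b * g t) * h t) =
      (LINT t|lebesgue_on T. a * (f t * h t) + b * (g t * h t))"
    by (simp add: algebra_simps)
  also have "\<dots> = a * inner_L2 T f h + b * inner_L2 T g h"
    unfolding inner_L2_def using assms
    by (subst Bochner_Integration.integral_add) (auto intro: L2_mult_integrable)
  finally show ?thesis unfolding inner_L2_def .
qed

context
  fixes T :: "'a::euclidean_space set"
  assumes T: "T \<in> sets lebesgue"
begin

lemma indicator_L2: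
  assumes "f \<in> L2 T"
  shows "(\<lambda>t. indicator T t * f t) \<in> L2 UNIV"
proof (rule L2I)
  show "(\<lambda>t. indicator T t * f t) \<in> borel_measurable (lebesgue_on UNIV)"
    using L2_measurable[OF assms] borel_measurable_restrict_space_iff[of T lebesgue f] T
    by (simp add: lebesgue_on_UNIV_eq)
  have "integrable lebesgue (\<lambda>t. indicator T t *\<^sub>R (f t)\<^sup>2)"
    using L2_square_integrable[OF assms] T by (subst (asm) integrable_restrict_space) auto
  moreover have "indicator T t *\<^sub>R (f t)\<^sup>2 = (indicator T t * f t)\<^sup>2" for t
    by (simp add: indicator_def)
  ultimately show "integrable (lebesgue_on UNIV) (\<lambda>t. (indicator T t * f t)\<^sup>2)"
    by (simp add: lebesgue_on_UNIV_eq)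
qed

lemma rep_l2_L2_on: "rep_l2 x \<in> L2 T"
proof (rule L2I)
  show "rep_l2 x \<in> borel_measurable (lebesgue_on T)"
    using L2_measurable[OF rep_l2_L2[of x]] by (intro measurable_restrict_space1) (simp add: lebesgue_on_UNIV_eq)
  have "integrable lebesgue (\<lambda>t. indicator T t *\<^sub>R (rep_l2 x t)\<^sup>2)"
    using L2_square_integrable[OF rep_l2_L2[of x]] T
    by (intro integrable_mult_indicator) (auto simp: lebesgue_on_UNIV_eq)
  then show "integrable (lebesgue_on T) (\<lambda>t. (rep_l2 x t)\<^sup>2)"
    using T by (subst integrable_restrict_space) auto
qed

lemma eq_L2_UNIV_on: "eq_L2 UNIV f g \<Longrightarrow> eq_L2 T f g"
  using T unfolding eq_L2_def by (auto simp: AE_restrict_space_iff lebesgue_on_UNIV_eq elim!: eventually_mono)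

lemma eq_L2_indicator:
  "eq_L2 UNIV (\<lambda>t. indicator T t * f t) (\<lambda>t. indicator T t * g t) \<longleftrightarrow> eq_L2 T f g"
  using T unfolding eq_L2_def
  by (auto simp: AE_restrict_space_iff lebesgue_on_UNIV_eq indicator_def)

lemma embed_L2_eq_iff:
  "f \<in> L2 T \<Longrightarrow> g \<in> L2 T \<Longrightarrow> embed_L2 T f = embed_L2 T g \<longleftrightarrow> eq_L2 T f g"
  unfolding embed_L2_def by (simp add: abs_l2_eq_iff indicator_L2 eq_L2_indicator)

lemma rep_embed_L2: 
  assumes "f \<in> L2 T"
  shows "eq_L2 T (rep_l2 (embed_L2 T f)) f"
proof -
  have "eq_L2 T (rep_l2 (embed_L2 T f)) (\<lambda>t. indicator T t * f t)"
    unfolding embed_L2_def by (intro eq_L2_UNIV_on rep_abs_l2 indicator_L2 assms)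
  moreover have "eq_L2 T (\<lambda>t. indicator T t * f t) f"
    unfolding eq_L2_def by (rule AE_I2) simp
  ultimately show ?thesis by (rule eq_L2_trans)
qed

lemma embed_L2_lincomb:
  assumes "f \<in> L2 T" "g \<in> L2 T"
  shows "embed_L2 T (\<lambda>t. a * f t + b * g t) = a *\<^sub>R embed_L2 T f + b *\<^sub>R embed_L2 T g"
  unfolding embed_L2_def using abs_l2_lincomb[OF assms[THEN indicator_L2], of a b]
  by (simp add: algebra_simps)

lemma embed_L2_scale: "f \<in> L2 T \<Longrightarrow> embed_L2 T (\<lambda>t. a * f t) = a *\<^sub>R embed_L2 T f"
  using embed_L2_lincomb[of f f a 0] by simp

lemma embed_L2_zero: "embed_L2 T (\<lambda>t. 0) = 0"
  using embed_L2_scale[OF L2_zero, of 0] by simp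

lemma embed_L2_diff:
  "f \<in> L2 T \<Longrightarrow> g \<in> L2 T \<Longrightarrow> embed_L2 T (\<lambda>t. f t - g t) = embed_L2 T f - embed_L2 T g"
  using embed_L2_lincomb[of f g 1 "-1"] by simp

lemma inner_embed_L2:
  assumes "f \<in> L2 T" "g \<in> L2 T"
  shows "embed_L2 T f \<bullet> embed_L2 T g = inner_L2 T f g"
proof -
  have "embed_L2 T f \<bullet> embed_L2 T g =
      (LINT t|lebesgue. (indicator T t * f t) * (indicator T t * g t))"
    unfolding embed_L2_def using assms
    by (simp add: inner_abs_l2 indicator_L2 inner_L2_def lebesgue_on_UNIV_eq)
  also have "\<dots> = (LINT t|lebesgue. indicator T t *\<^sub>R (f t * g t))"
    by (intro Bochner_Integration.integral_cong) (auto simp: indicator_def)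
  also have "\<dots> = inner_L2 T f g"
    unfolding inner_L2_def using T by (subst integral_restrict_space) auto
  finally show ?thesis .
qed

lemma norm_embed_L2: "f \<in> L2 T \<Longrightarrow> norm (embed_L2 T f) = norm_L2 T f"
  by (simp add: norm_eq_sqrt_inner inner_embed_L2 norm_L2_def)

text \<open>Extension of \<open>f\<close> by zero cuts the product to \<open>T\<close>, so
  \<open>x\<close> may be nonzero elsewhere.\<close>

lemma inner_embed_L2_left:
  assumes "f \<in> L2 T"
  shows "embed_L2 T f \<bullet> x = inner_L2 T f (rep_l2 x)"
proof -
  have "embed_L2 T f \<bullet> x = inner_L2 UNIV (\<lambda>t. indicator T t * f t) (rep_l2 x)"
    unfolding embed_L2_def
    by (subst (1) abs_rep_l2[of x, symmetric]) (simp add: inner_abs_l2 indicator_L2 assms rep_l2_L2)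
  also have "\<dots> = (LINT t|lebesgue. indicator T t *\<^sub>R (f t * rep_l2 x t))"
    by (simp add: inner_L2_def lebesgue_on_UNIV_eq mult.assoc)
  also have "\<dots> = inner_L2 T f (rep_l2 x)"
    unfolding inner_L2_def using T by (subst integral_restrict_space) auto
  finally show ?thesis .
qed

lemma Cauchy_Schwarz_L2:
  "f \<in> L2 T \<Longrightarrow> g \<in> L2 T \<Longrightarrow> \<bar>inner_L2 T f g\<bar> \<le> norm_L2 T f * norm_L2 T g"
  using Cauchy_Schwarz_ineq2[of "embed_L2 T f" "embed_L2 T g"]
  by (simp add: inner_embed_L2 norm_embed_L2)

lemma norm_rep_l2_le: "norm_L2 T (rep_l2 x) \<le> norm x"
proof -
  have "(norm_L2 T (rep_l2 x))\<^sup>2 = embed_L2 T (rep_l2 x) \<bullet> x"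
    unfolding inner_embed_L2_left[OF rep_l2_L2_on]
    by (simp add: norm_L2_def inner_L2_self)
  also have "\<dots> \<le> norm_L2 T (rep_l2 x) * norm x"
    using norm_cauchy_schwarz[of "embed_L2 T (rep_l2 x)" x] by (simp add: norm_embed_L2 rep_l2_L2_on)
  finally have "norm_L2 T (rep_l2 x) * norm_L2 T (rep_l2 x) \<le> norm_L2 T (rep_l2 x) * norm x"
    by (simp add: power2_eq_square)
  then show ?thesis
    by (metis mult_left_le_imp_le norm_embed_L2 norm_ge_zero order_le_less rep_l2_L2_on)
qed

lemma rep_l2_lincomb:
  "eq_L2 T (rep_l2 (a *\<^sub>R x + b *\<^sub>R y)) (\<lambda>t. a * rep_l2 x t + b * rep_l2 y t)"
proof -
  have "eq_L2 UNIV (rep_l2 (abs_l2 (\<lambda>t. a * rep_l2 x t + b * rep_l2 y t)))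
      (\<lambda>t. a * rep_l2 x t + b * rep_l2 y t)"
    by (intro rep_abs_l2 L2_lincomb rep_l2_L2)
  then show ?thesis
    by (intro eq_L2_UNIV_on) (simp add: abs_l2_lincomb rep_l2_L2 abs_rep_l2)
qed

lemma bounded_linear_L2_cong:
  assumes A: "bounded_linear_L2 T A" and f: "f \<in> L2 T" and g: "g \<in> L2 T" and fg: "eq_L2 T f g"
  shows "eq_L2 T (A f) (A g)"
proof -
  obtain B where B: "\<And>f. f \<in> L2 T \<Longrightarrow> norm_L2 T (A f) \<le> B * norm_L2 T f"
    using A unfolding bounded_linear_L2_def by blast
  have AL2: "A f \<in> L2 T" if "f \<in> L2 T" for f
    using A that unfolding bounded_linear_L2_def by blast
  let ?d = "\<lambda>t. 1 * f t + (- 1) * g t"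
  have d: "?d \<in> L2 T" using f g by (rule L2_lincomb)
  have "eq_L2 T ?d (\<lambda>t. 0)"
    using fg unfolding eq_L2_def by simp
  then have "embed_L2 T ?d = 0"
    using embed_L2_eq_iff[OF d L2_zero] embed_L2_zero by simp
  then have "norm_L2 T ?d = 0"
    using norm_embed_L2[OF d] by simp
  then have "norm (embed_L2 T (A ?d)) \<le> 0"
    using B[OF d] AL2[OF d] by (simp add: norm_embed_L2)
  moreover have "embed_L2 T (A ?d) = embed_L2 T (\<lambda>t. 1 * A f t + (- 1) * A g t)"
    using A f g unfolding bounded_linear_L2_def
    by (subst embed_L2_eq_iff) (blast intro: L2_lincomb d)+
  ultimately show ?thesis
    using embed_L2_eq_iff AL2 f g embed_L2_lincomb[of "A f" "A g" 1 "-1"] by simp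
qed

lemma lift_L2_embed:
  assumes "bounded_linear_L2 T A" and "f \<in> L2 T"
  shows "lift_L2 T A (embed_L2 T f) = embed_L2 T (A f)"
proof -
  have "eq_L2 T (A (rep_l2 (embed_L2 T f))) (A f)"
    by (rule bounded_linear_L2_cong[OF assms(1) rep_l2_L2_on assms(2) rep_embed_L2[OF assms(2)]])
  then show ?thesis
    using assms rep_l2_L2_on unfolding lift_L2_def bounded_linear_L2_def
    by (subst embed_L2_eq_iff) auto
qed

lemma lift_L2_bounded_linear:
  assumes A: "bounded_linear_L2 T A"
  shows "bounded_linear (lift_L2 T A)"
proof -
  have AL2: "A f \<in> L2 T" if "f \<in> L2 T" for f
    using A that unfolding bounded_linear_L2_def by blast
  obtain B where B: "\<And>f. f \<in> L2 T \<Longrightarrow> norm_L2 T (A f) \<le> B * norm_L2 T f"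
    using A unfolding bounded_linear_L2_def by blast
  have lin: "lift_L2 T A (a *\<^sub>R x + b *\<^sub>R y) = a *\<^sub>R lift_L2 T A x + b *\<^sub>R lift_L2 T A y" for a b x y
  proof -
    have "eq_L2 T (A (rep_l2 (a *\<^sub>R x + b *\<^sub>R y))) (A (\<lambda>t. a * rep_l2 x t + b * rep_l2 y t))"
      by (rule bounded_linear_L2_cong[OF A rep_l2_L2_on L2_lincomb[OF rep_l2_L2_on rep_l2_L2_on] rep_l2_lincomb])
    moreover have "eq_L2 T (A (\<lambda>t. a * rep_l2 x t + b * rep_l2 y t))
        (\<lambda>t. a * A (rep_l2 x) t + b * A (rep_l2 y) t)"
      using A rep_l2_L2_on unfolding bounded_linear_L2_def by blast
    ultimately have "eq_L2 T (A (rep_l2 (a *\<^sub>R x + b *\<^sub>R y)))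
        (\<lambda>t. a * A (rep_l2 x) t + b * A (rep_l2 y) t)"
      by (rule eq_L2_trans)
    then show ?thesis
      unfolding lift_L2_def
      by (simp add: embed_L2_eq_iff[symmetric] AL2 rep_l2_L2_on L2_lincomb embed_L2_lincomb)
  qed
  have "norm (lift_L2 T A x) \<le> norm x * \<bar>B\<bar>" for x
  proof -
    have "norm (lift_L2 T A x) \<le> B * norm_L2 T (rep_l2 x)"
      unfolding lift_L2_def using B[OF rep_l2_L2_on] by (simp add: norm_embed_L2 AL2 rep_l2_L2_on)
    also have "\<dots> \<le> \<bar>B\<bar> * norm x"
      using norm_rep_l2_le[of x] norm_ge_zero[of "embed_L2 T (rep_l2 x)"]
      by (intro mult_mono) (auto simp: norm_embed_L2 rep_l2_L2_on)
    finally show ?thesis by (simp add: mult.commute)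
  qed
  then show ?thesis
    using lin[of 1 _ 1] lin[of _ _ 0] by (intro bounded_linear_intro[where K = "\<bar>B\<bar>"]) auto
qed

end

text \<open>If \<open>c\<close> is nonzero, \<open>x\<close> vanishes off \<open>T\<close> and
  equals the restriction of its representative. Eigenvector equations in \<open>l2\<close> are moved
  back by this to functions on \<open>T\<close>, where the hypotheses are stated.\<close>

lemma embed_rep_of_range:
  fixes T :: "'a::euclidean_space set"
  assumes "T \<in> sets lebesgue" and "f \<in> L2 T" and "c *\<^sub>R x = embed_L2 T f"
  shows "c *\<^sub>R x = c *\<^sub>R embed_L2 T (rep_l2 x)"
proof (cases "c = 0")
  case False
  define g where "g t = (1 / c) * f t" for t
  have g: "g \<in> L2 T"
    unfolding g_def using assms(2) by (rule L2_scale)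
  have "x = (1 / c) *\<^sub>R (c *\<^sub>R x)" using False by simp
  also have "\<dots> = embed_L2 T g"
    unfolding assms(3) g_def by (rule embed_L2_scale[OF assms(1,2), symmetric])
  finally have "embed_L2 T (rep_l2 x) = x"
    using rep_embed_L2[OF assms(1) g] by (simp add: embed_L2_eq_iff[OF assms(1) rep_l2_L2_on[OF assms(1)] g])
  then show ?thesis by simp
qed simp

subsection \<open>Covariance operators\<close>

text \<open>The integrand is dominated by \<open>Y^2 + g^2 * W^2\<close>, which is integrable on the
  product.\<close>

lemma (in pair_sigma_finite) Fubini_square_integrable:
  fixes Y :: "'a \<Rightarrow> 'b \<Rightarrow> real"
  assumes Y[measurable]: "(\<lambda>(t, w). Y t w) \<in> borel_measurable (M1 \<Otimes>\<^sub>M M2)"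
    and Y2: "integrable (M1 \<Otimes>\<^sub>M M2) (\<lambda>(t, w). (Y t w)\<^sup>2)"
    and g[measurable]: "g \<in> borel_measurable M1" and g2: "integrable M1 (\<lambda>t. (g t)\<^sup>2)"
    and W[measurable]: "W \<in> borel_measurable M2" and W2: "integrable M2 (\<lambda>w. (W w)\<^sup>2)"
  shows "(LINT t|M1. g t * (LINT w|M2. Y t w * W w)) = (LINT w|M2. (LINT t|M1. Y t w * g t) * W w)"
proof -
  have gW: "integrable (M1 \<Otimes>\<^sub>M M2) (\<lambda>(t, w). (g t)\<^sup>2 * (W w)\<^sup>2)"
    using g2 W2 by (intro Fubini_integrable) auto
  have "integrable (M1 \<Otimes>\<^sub>M M2) (\<lambda>(t, w). g t * (Y t w * W w))"
  proof (rule Bochner_Integration.integrable_bound[OF Bochner_Integration.integrable_add[OF Y2 gW]])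
    show "AE p in M1 \<Otimes>\<^sub>M M2. norm (case p of (t, w) \<Rightarrow> g t * (Y t w * W w)) \<le>
        norm ((case p of (t, w) \<Rightarrow> (Y t w)\<^sup>2) + (case p of (t, w) \<Rightarrow> (g t)\<^sup>2 * (W w)\<^sup>2))"
    proof (rule AE_I2, clarsimp)
      fix t w
      have "2 * \<bar>Y t w * (g t * W w)\<bar> \<le> (Y t w)\<^sup>2 + (g t * W w)\<^sup>2"
        using sum_squares_bound[of "\<bar>Y t w\<bar>" "\<bar>g t * W w\<bar>"]
        unfolding abs_mult[of "Y t w"] by (simp add: mult.assoc)
      moreover have "\<bar>g t * (Y t w * W w)\<bar> = \<bar>Y t w * (g t * W w)\<bar>"
        by (simp add: mult.left_commute)
      ultimately show "\<bar>g t * (Y t w * W w)\<bar> \<le> (Y t w)\<^sup>2 + (g t)\<^sup>2 * (W w)\<^sup>2"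
        by (simp add: power_mult_distrib)
    qed
  qed measurable
  then have "(LINT t|M1. LINT w|M2. g t * (Y t w * W w)) = (LINT w|M2. LINT t|M1. g t * (Y t w * W w))"
    by (rule Fubini_integral[symmetric])
  also have "\<dots> = (LINT w|M2. LINT t|M1. (Y t w * g t) * W w)"
    by (simp add: ac_simps)
  finally show ?thesis by simp
qed

text \<open>\<open>c\<close> stands for the squared norm of \<open>g\<close>. Cauchy-Schwarz is
  passed in as \<open>CS\<close>, to be supplied from the inner product of \<open>l2\<close>; it
  applies to almost every section of \<open>Y\<close>.\<close>

lemma (in pair_sigma_finite) integral_fst_square_integrable:
  fixes Y :: "'a \<Rightarrow> 'b \<Rightarrow> real"
  assumes Y[measurable]: "(\<lambda>(t, w). Y t w) \<in> borel_measurable (M1 \<Otimes>\<^sub>M M2)"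
    and Y2: "integrable (M1 \<Otimes>\<^sub>M M2) (\<lambda>(t, w). (Y t w)\<^sup>2)"
    and g[measurable]: "g \<in> borel_measurable M1"
    and CS: "\<And>h. h \<in> borel_measurable M1 \<Longrightarrow> integrable M1 (\<lambda>t. (h t)\<^sup>2) \<Longrightarrow>
      (LINT t|M1. h t * g t)\<^sup>2 \<le> (LINT t|M1. (h t)\<^sup>2) * c"
  shows "(\<lambda>w. LINT t|M1. Y t w * g t) \<in> borel_measurable M2"
    and "integrable M2 (\<lambda>w. (LINT t|M1. Y t w * g t)\<^sup>2)"
proof -
  show [measurable]: "(\<lambda>w. LINT t|M1. Y t w * g t) \<in> borel_measurable M2"
    by measurable
  have "integrable M2 (\<lambda>w. (LINT t|M1. (Y t w)\<^sup>2) * c)"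
    using integrable_snd[OF Y2] by (rule integrable_mult_left)
  then show "integrable M2 (\<lambda>w. (LINT t|M1. Y t w * g t)\<^sup>2)"
  proof (rule Bochner_Integration.integrable_bound)
    show "AE w in M2. norm ((LINT t|M1. Y t w * g t)\<^sup>2) \<le> norm ((LINT t|M1. (Y t w)\<^sup>2) * c)"
      using AE_integrable_snd[OF Y2] AE_space
    proof eventually_elim
      case (elim w)
      then show ?case using CS[of "\<lambda>t. Y t w"] by force
    qed
  qed measurable
qed

lemma continuous_on_kernel_section:
  assumes "continuous_on (T \<times> T) (\<lambda>(s, t). k s t)" and "s \<in> T"
  shows "continuous_on T (k s)" and "continuous_on T (\<lambda>t. k t s)"
proof -
  have "continuous_on T (\<lambda>t. (\<lambda>(s, t). k s t) (s, t))"
    using assms(2) by (intro continuous_on_compose2[OF assms(1)] continuous_intros) auto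
  then show "continuous_on T (k s)" by simp
  have "continuous_on T (\<lambda>t. (\<lambda>(s, t). k s t) (t, s))"
    using assms(2) by (intro continuous_on_compose2[OF assms(1)] continuous_intros) auto
  then show "continuous_on T (\<lambda>t. k t s)" by simp
qed

context
  fixes T :: "'a::euclidean_space set"
  assumes T: "compact T"
begin

lemma compact_imp_lebesgue_set: "T \<in> sets lebesgue"
  using lmeasurable_compact[OF T] by (rule fmeasurableD)

lemma finite_measure_lebesgue_on_compact: "finite_measure (lebesgue_on T)"
  by (rule finite_measure_lebesgue_on[OF lmeasurable_compact[OF T]])

lemma bounded_measurable_L2:
  assumes "f \<in> borel_measurable (lebesgue_on T)" and "\<And>t. t \<in> T \<Longrightarrow> \<bar>f t\<bar> \<le> b"
  shows "f \<in> L2 T"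
proof (rule L2I)
  have "(f t)\<^sup>2 \<le> b\<^sup>2" if "t \<in> T" for t
    using power_mono[OF assms(2)[OF that], of 2] by simp
  then show "integrable (lebesgue_on T) (\<lambda>t. (f t)\<^sup>2)"
    using assms(1) finite_measure_lebesgue_on_compact
    by (intro finite_measure.integrable_const_bound[where B = "b\<^sup>2"]) auto
qed (fact assms(1))

lemma continuous_L2:
  assumes "continuous_on T f"
  shows "f \<in> L2 T"
proof -
  have "bounded (f ` T)"
    using compact_continuous_image[OF assms T] by (rule compact_imp_bounded)
  then obtain b where "\<And>t. t \<in> T \<Longrightarrow> \<bar>f t\<bar> \<le> b"
    by (auto simp: bounded_iff)
  then show ?thesis
    using continuous_imp_measurable_on_sets_lebesgue[OF assms compact_imp_lebesgue_set]
    by (rule_tac bounded_measurable_L2)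
qed

lemma L2_integrable:
  assumes "f \<in> L2 T"
  shows "integrable (lebesgue_on T) f"
  using L2_mult_integrable[OF assms continuous_L2[of "\<lambda>_. 1"]] by simp

lemma norm_L2_le_bound:
  assumes "f \<in> L2 T" and "\<And>t. t \<in> T \<Longrightarrow> \<bar>f t\<bar> \<le> b" and "b \<ge> 0"
  shows "norm_L2 T f \<le> b * sqrt (measure lebesgue T)"
proof -
  interpret finite_measure "lebesgue_on T" by (rule finite_measure_lebesgue_on_compact)
  have "inner_L2 T f f \<le> (LINT t|lebesgue_on T. b\<^sup>2)"
    unfolding inner_L2_self using power_mono[OF assms(2), of _ 2]
    by (intro integral_mono) (auto intro: L2_square_integrable assms)
  also have "\<dots> = b\<^sup>2 * measure lebesgue T"
    using compact_imp_lebesgue_set by (simp add: measure_restrict_space)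
  finally show ?thesis
    unfolding norm_L2_def using \<open>b \<ge> 0\<close> real_sqrt_le_mono by (fastforce simp: real_sqrt_mult)
qed

lemma continuous_kernel_bounded:
  fixes k :: "'a \<Rightarrow> 'a \<Rightarrow> real"
  assumes "continuous_on (T \<times> T) (\<lambda>(s, t). k s t)"
  shows "\<exists>\<kappa>\<ge>0. \<forall>s\<in>T. \<forall>t\<in>T. \<bar>k s t\<bar> \<le> \<kappa>"
proof -
  have "bounded ((\<lambda>(s, t). k s t) ` (T \<times> T))"
    using compact_continuous_image[OF assms compact_Times[OF T T]] by (rule compact_imp_bounded)
  then obtain b where "\<forall>x\<in>(\<lambda>(s, t). k s t) ` (T \<times> T). norm x \<le> b"
    unfolding bounded_iff by blast
  then have b: "\<bar>k s t\<bar> \<le> b" if "s \<in> T" "t \<in> T" for s t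
    using that by force
  then show ?thesis
    by (intro exI[of _ "\<bar>b\<bar>"]) (auto intro: order_trans[OF _ abs_ge_self])
qed

lemma bounded_linear_L2_integral_op:
  fixes k :: "'a \<Rightarrow> 'a \<Rightarrow> real"
  assumes k: "continuous_on (T \<times> T) (\<lambda>(s, t). k s t)"
  shows "bounded_linear_L2 T (integral_op T k)"
proof -
  obtain \<kappa> where \<kappa>: "\<kappa> \<ge> 0" "\<And>s t. s \<in> T \<Longrightarrow> t \<in> T \<Longrightarrow> \<bar>k s t\<bar> \<le> \<kappa>"
    using continuous_kernel_bounded[OF k] by blast
  define m where "m = sqrt (measure lebesgue T)"
  have section_L2: "k s \<in> L2 T" if "s \<in> T" for s
    by (rule continuous_L2[OF continuous_on_kernel_section(1)[OF k that]])
  have bound: "\<bar>integral_op T k f s\<bar> \<le> \<kappa> * m * norm_L2 T f" if "s \<in> T" "f \<in> L2 T" for s f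
  proof -
    have "\<bar>integral_op T k f s\<bar> \<le> norm_L2 T (k s) * norm_L2 T f"
      using Cauchy_Schwarz_L2[OF compact_imp_lebesgue_set section_L2[OF that(1)] that(2)]
      unfolding inner_L2_def integral_op_def .
    also have "\<dots> \<le> \<kappa> * m * norm_L2 T f"
      unfolding m_def using \<kappa> that section_L2 norm_ge_zero[of "embed_L2 T f"]
      by (intro mult_right_mono norm_L2_le_bound) (auto simp: norm_embed_L2[OF compact_imp_lebesgue_set])
    finally show ?thesis .
  qed
  \<comment> \<open>Dominated convergence with majorant \<open>\<kappa> * \<bar>f t\<bar>\<close>.
    Continuity also supplies measurability of the image and hence its membership in
    \<open>L2 T\<close>.\<close>
  have cont: "continuous_on T (integral_op T k f)" if f: "f \<in> L2 T" for f
    unfolding continuous_on_sequentially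
  proof (intro allI ballI impI, elim conjE)
    fix x s assume s: "s \<in> T" and x: "\<forall>n. x n \<in> T" "x \<longlonglongrightarrow> s"
    have "(\<lambda>n. LINT t|lebesgue_on T. k (x n) t * f t) \<longlonglongrightarrow> (LINT t|lebesgue_on T. k s t * f t)"
    proof (rule integral_dominated_convergence)
      show "integrable (lebesgue_on T) (\<lambda>t. \<kappa> * \<bar>f t\<bar>)"
        using L2_integrable[OF f] by simp
      show "AE t in lebesgue_on T. (\<lambda>n. k (x n) t * f t) \<longlonglongrightarrow> k s t * f t"
      proof (rule AE_I2)
        fix t assume "t \<in> space (lebesgue_on T)"
        then have "t \<in> T" by simp
        then have "(\<lambda>n. k (x n) t) \<longlonglongrightarrow> k s t"
          using continuous_on_kernel_section(2)[OF k] x s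
          unfolding continuous_on_sequentially comp_def by blast
        then show "(\<lambda>n. k (x n) t * f t) \<longlonglongrightarrow> k s t * f t"
          by (intro tendsto_intros)
      qed
      show "AE t in lebesgue_on T. norm (k (x n) t * f t) \<le> \<kappa> * \<bar>f t\<bar>" for n
        using \<kappa> x(1) by (intro AE_I2) (auto simp: abs_mult intro!: mult_right_mono)
    qed (use L2_measurable[OF f] L2_measurable[OF section_L2] s x(1) in \<open>auto intro!: borel_measurable_times\<close>)
    then show "(integral_op T k f \<circ> x) \<longlonglongrightarrow> integral_op T k f s"
      unfolding integral_op_def comp_def .
  qed
  have "integral_op T k (\<lambda>t. a * f t + b * g t) s = a * integral_op T k f s + b * integral_op T k g s"
    if "f \<in> L2 T" "g \<in> L2 T" "s \<in> T" for f g a b s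
    using inner_L2_lincomb_left[of f T g "k s" a b] that section_L2
    unfolding inner_L2_def integral_op_def by (simp add: mult.commute)
  then have "eq_L2 T (integral_op T k (\<lambda>t. a * f t + b * g t))
      (\<lambda>t. a * integral_op T k f t + b * integral_op T k g t)" if "f \<in> L2 T" "g \<in> L2 T" for f g a b
    using that unfolding eq_L2_def by (intro AE_I2) simp
  moreover have "norm_L2 T (integral_op T k f) \<le> \<kappa> * m * m * norm_L2 T f" if "f \<in> L2 T" for f
  proof -
    have "norm_L2 T f \<ge> 0" "m \<ge> 0"
      using norm_embed_L2[OF compact_imp_lebesgue_set that, symmetric] by (auto simp: m_def)
    then show ?thesis
      using norm_L2_le_bound[OF continuous_L2[OF cont[OF that]] bound[OF _ that]] \<kappa>(1)
      unfolding m_def[symmetric] by (simp add: ac_simps)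
  qed
  ultimately show ?thesis
    unfolding bounded_linear_L2_def using continuous_L2[OF cont] by blast
qed

text \<open>\<open>Z f\<close> is the integral of the centred process against \<open>f\<close>, and
  the covariance form is the second moment of \<open>Z f\<close> and \<open>Z g\<close>. Symmetry
  and nonnegativity of the operator can then be read off.\<close>

lemma inner_covariance_op:
  fixes M :: "'w measure" and X :: "'w \<Rightarrow> 'a \<Rightarrow> real"
  assumes M: "prob_space M"
    and X: "square_integrable_process T M X"
    and cont: "continuous_on (T \<times> T) (\<lambda>(s, t). covariance M X s t)"
  shows "\<exists>Z. \<forall>f\<in>L2 T. \<forall>g\<in>L2 T.
    inner_L2 T (integral_op T (covariance M X) f) g = (LINT w|M. Z f w * Z g w)"
proof -
  interpret M: prob_space M by (fact M)
  let ?N = "lebesgue_on T"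
  interpret N: finite_measure ?N by (rule finite_measure_lebesgue_on_compact)
  interpret NM: pair_sigma_finite ?N M ..
  have XMN: "(\<lambda>(w, t). X w t) \<in> borel_measurable (M \<Otimes>\<^sub>M ?N)"
    and X2: "\<And>t. t \<in> T \<Longrightarrow> integrable M (\<lambda>w. (X w t)\<^sup>2)"
    using X unfolding square_integrable_process_def by auto
  have XNM[measurable]: "(\<lambda>(t, w). X w t) \<in> borel_measurable (?N \<Otimes>\<^sub>M M)"
    using measurable_pair_swap[OF XMN] by simp
  have Xt[measurable]: "(\<lambda>w. X w t) \<in> borel_measurable M" if "t \<in> T" for t
    using measurable_Pair2[OF XNM, of t] that by simp
  define Y where "Y t w = X w t - (LINT w'|M. X w' t)" for t w
  have Y[measurable]: "(\<lambda>(t, w). Y t w) \<in> borel_measurable (?N \<Otimes>\<^sub>M M)"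
    unfolding Y_def by measurable
  have Yt[measurable]: "Y t \<in> borel_measurable M" if "t \<in> T" for t
    unfolding Y_def using that by measurable
  have cov: "covariance M X s t = (LINT w|M. Y s w * Y t w)" for s t
    unfolding covariance_def Y_def ..
  have Yt2: "integrable M (\<lambda>w. (Y t w)\<^sup>2)" if "t \<in> T" for t
  proof -
    have "integrable M (\<lambda>w. X w t)"
      using M.square_integrable_imp_integrable[OF Xt X2] that by blast
    then have "integrable M (\<lambda>w. (X w t)\<^sup>2 - 2 * (LINT w'|M. X w' t) * X w t + (LINT w'|M. X w' t)\<^sup>2)"
      using X2[OF that] by (intro Bochner_Integration.integrable_add Bochner_Integration.integrable_diff) auto
    then show ?thesis
      unfolding Y_def by (simp add: power2_diff algebra_simps)
  qed
  \<comment> \<open>The diagonal of the covariance is the second moment of \<open>Y t\<close>; being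
    continuous it is integrable over \<open>T\<close>, which gives joint square integrability of
    \<open>Y\<close>.\<close>
  have "continuous_on T (\<lambda>t. (\<lambda>(s, t). covariance M X s t) (t, t))"
    by (intro continuous_on_compose2[OF cont] continuous_intros) auto
  then have "integrable ?N (\<lambda>t. covariance M X t t)"
    using L2_integrable[OF continuous_L2] by simp
  then have Y2: "integrable (?N \<Otimes>\<^sub>M M) (\<lambda>(t, w). (Y t w)\<^sup>2)"
    by (intro NM.Fubini_integrable AE_I2) (auto simp: cov power2_eq_square Yt2[unfolded power2_eq_square])
  define Z where "Z f w = (LINT t|?N. Y t w * f t)" for f w
  have Z: "Z f \<in> borel_measurable M \<and> integrable M (\<lambda>w. (Z f w)\<^sup>2)" if f: "f \<in> L2 T" for f
  proof -
    have "(LINT t|?N. h t * f t)\<^sup>2 \<le> (LINT t|?N. (h t)\<^sup>2) * inner_L2 T f f"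
      if "h \<in> borel_measurable ?N" "integrable ?N (\<lambda>t. (h t)\<^sup>2)" for h
      using Cauchy_Schwarz_ineq[of "embed_L2 T h" "embed_L2 T f"] L2I[OF that] f
      by (simp add: inner_embed_L2[OF compact_imp_lebesgue_set]) (simp add: inner_L2_def power2_eq_square)
    then show ?thesis
      unfolding Z_def
      using NM.integral_fst_square_integrable[OF Y Y2 L2_measurable[OF f]]
      by blast
  qed
  have op: "integral_op T (covariance M X) f s = (LINT w|M. Y s w * Z f w)" if "s \<in> T" "f \<in> L2 T" for f s
  proof -
    have "integral_op T (covariance M X) f s = (LINT t|?N. f t * (LINT w|M. Y t w * Y s w))"
      unfolding integral_op_def cov by (simp add: mult.commute)
    also have "\<dots> = (LINT w|M. Z f w * Y s w)"
      unfolding Z_def using that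
      by (intro NM.Fubini_square_integrable Y Y2 L2_measurable L2_square_integrable Yt Yt2)
    finally show ?thesis by (simp add: mult.commute)
  qed
  have "inner_L2 T (integral_op T (covariance M X) f) g = (LINT w|M. Z f w * Z g w)"
    if f: "f \<in> L2 T" and g: "g \<in> L2 T" for f g
  proof -
    have "inner_L2 T (integral_op T (covariance M X) f) g = (LINT s|?N. g s * (LINT w|M. Y s w * Z f w))"
      unfolding inner_L2_def using op f
      by (intro Bochner_Integration.integral_cong) (auto simp: mult.commute)
    also have "\<dots> = (LINT w|M. Z g w * Z f w)"
      unfolding Z_def[of g] using Z[OF f]
      by (intro NM.Fubini_square_integrable Y Y2 L2_measurable L2_square_integrable g) auto
    finally show ?thesis by (simp add: mult.commute)
  qed
  then show ?thesis by blast
qed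

end

subsection \<open>Penalized reproducing kernel Hilbert spaces\<close>

text \<open>The projection is written as a sum of rank-one maps, so that compactness and pointwise
  bounds can be obtained term by term.\<close>

lemma finite_dim_projection:
  fixes V :: "'h::real_inner set"
  assumes "finite_dim_subspace V"
  shows "\<exists>E \<phi>. finite E \<and> E \<subseteq> V \<and> (\<forall>e\<in>E. bounded_linear (\<phi> e)) \<and>
    (\<forall>f. (\<Sum>e\<in>E. \<phi> e f *\<^sub>R e) \<in> V \<and> f - (\<Sum>e\<in>E. \<phi> e f *\<^sub>R e) \<in> orth_complement V)"
proof -
  obtain B where "finite B" "V = span B"
    using assms unfolding finite_dim_subspace_def by blast
  then obtain E where E: "finite E" "V = span E" "pairwise orthogonal E"
    using basis_orthogonal[of B] by auto
  \<comment> \<open>\<open>E\<close> may contain 0; division by zero then makes its coefficient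
    0.\<close>
  define \<phi> where "\<phi> e f = (f \<bullet> e) / (e \<bullet> e)" for e f :: 'h
  have "bounded_linear (\<phi> e)" for e
    unfolding \<phi>_def by (intro bounded_linear_divide[THEN bounded_linear_compose] bounded_linear_inner_left)
  moreover have "(\<Sum>e\<in>E. \<phi> e f *\<^sub>R e) \<in> V" for f
    unfolding E(2) by (intro span_sum span_scale span_base)
  moreover have "f - (\<Sum>e\<in>E. \<phi> e f *\<^sub>R e) \<in> orth_complement V" for f
  proof -
    have "(f - (\<Sum>e\<in>E. \<phi> e f *\<^sub>R e)) \<bullet> d = 0" if "d \<in> E" for d
    proof -
      have "(\<Sum>e\<in>E. \<phi> e f *\<^sub>R e) \<bullet> d = (\<Sum>e\<in>E. if e = d then \<phi> d f * (d \<bullet> d) else 0)"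
        unfolding inner_sum_left using E(3) that
        by (intro sum.cong) (auto simp: pairwise_def orthogonal_def)
      also have "\<dots> = f \<bullet> d"
        using that E(1) unfolding \<phi>_def by simp
      finally show ?thesis by (simp add: inner_diff_left)
    qed
    then have "span E \<subseteq> {d. orthogonal (f - (\<Sum>e\<in>E. \<phi> e f *\<^sub>R e)) d}"
      by (intro span_minimal subspace_orthogonal_to_vector) (auto simp: orthogonal_def)
    then show ?thesis
      unfolding orth_complement_def E(2) by blast
  qed
  ultimately show ?thesis
    using E(1,2) span_superset[of E] by (intro exI[of _ E] exI[of _ \<phi>]) simp
qed

text \<open>A sequence of unit vectors with \<open>B (f n) (f n) \<rightarrow> 0\<close> would have a limit point on the unit sphere.\<close>

lemma coercive_of_compact_projection:
  fixes B :: "'h::real_inner \<Rightarrow> 'h \<Rightarrow> real"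
  assumes B: "bounded_bilinear B" and P: "compact_operator P"
    and lower: "\<And>f. (norm (f - P f))\<^sup>2 \<le> B f f"
    and definite: "\<And>f. B f f = 0 \<Longrightarrow> f = 0"
  shows "\<exists>\<alpha>>0. \<forall>f. \<alpha> * (norm f)\<^sup>2 \<le> B f f"
proof (rule ccontr)
  interpret B: bounded_bilinear B by (fact B)
  assume neg: "\<not> ?thesis"
  have "\<exists>f. norm f = 1 \<and> B f f < inverse (real (Suc n))" for n
  proof -
    have "inverse (real (Suc n)) > 0" by simp
    then obtain f where f: "B f f < inverse (real (Suc n)) * (norm f)\<^sup>2"
      using neg by (meson not_le)
    then have "f \<noteq> 0" by (auto simp: B.zero_left)
    define g where "g = (1 / norm f) *\<^sub>R f"
    have "norm g = 1" unfolding g_def using \<open>f \<noteq> 0\<close> by simp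
    moreover have "B g g = B f f / (norm f)\<^sup>2"
      unfolding g_def by (simp add: B.scaleR_left B.scaleR_right power2_eq_square)
    then have "B g g < inverse (real (Suc n))"
      using f \<open>f \<noteq> 0\<close> by (simp add: pos_divide_less_eq)
    ultimately show ?thesis by blast
  qed
  then obtain g where g: "\<And>n. norm (g n) = 1" "\<And>n. B (g n) (g n) < inverse (real (Suc n))"
    by metis
  have small: "(norm (g n - P (g n)))\<^sup>2 \<le> inverse (real (Suc n))" "0 \<le> B (g n) (g n)" for n
    using lower[of "g n"] g(2)[of n] zero_le_power2[of "norm (g n - P (g n))"] by linarith+
  have "(\<lambda>n. (norm (g n - P (g n)))\<^sup>2) \<longlonglongrightarrow> 0"
    by (rule tendsto_sandwich[OF _ _ tendsto_const LIMSEQ_inverse_real_of_nat])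
      (use small in \<open>auto simp del: of_nat_Suc\<close>)
  then have "(\<lambda>n. sqrt ((norm (g n - P (g n)))\<^sup>2)) \<longlonglongrightarrow> sqrt 0"
    by (rule tendsto_real_sqrt)
  then have lim0: "(\<lambda>n. g n - P (g n)) \<longlonglongrightarrow> 0"
    by (simp add: tendsto_norm_zero_iff)
  \<comment> \<open>As \<open>g n - P (g n)\<close> tends to 0, convergence of
    \<open>P (g (r n))\<close> is convergence of \<open>g (r n)\<close> itself.\<close>
  obtain r l where r: "strict_mono r" "(\<lambda>n. P (g (r n))) \<longlonglongrightarrow> l"
    using compact_operatorD[of P g 1] P g(1) by auto
  have "(\<lambda>n. (g (r n) - P (g (r n))) + P (g (r n))) \<longlonglongrightarrow> 0 + l"
    using LIMSEQ_subseq_LIMSEQ[OF lim0 r(1)] by (intro tendsto_add r(2)) (simp add: o_def)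
  then have gl: "(\<lambda>n. g (r n)) \<longlonglongrightarrow> l" by simp
  have "norm l = 1"
    using tendsto_norm[OF gl] g(1) by (simp add: LIMSEQ_const_iff)
  have "(\<lambda>n. B (g n) (g n)) \<longlonglongrightarrow> 0"
    by (rule tendsto_sandwich[OF _ _ tendsto_const LIMSEQ_inverse_real_of_nat])
      (use g(2) small in \<open>auto intro!: always_eventually less_imp_le simp del: of_nat_Suc\<close>)
  then have "(\<lambda>n. B (g (r n)) (g (r n))) \<longlonglongrightarrow> 0"
    using LIMSEQ_subseq_LIMSEQ[OF _ r(1), of "\<lambda>n. B (g n) (g n)"] by (simp add: o_def)
  moreover have "(\<lambda>n. B (g (r n)) (g (r n))) \<longlonglongrightarrow> B l l"
    by (rule B.tendsto[OF gl gl])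
  ultimately have "B l l = 0"
    using LIMSEQ_unique by blast
  then show False
    using definite \<open>norm l = 1\<close> by force
qed

locale penalized_rkhs =
  fixes T :: "'a::euclidean_space set"
    and val :: "'h::{real_inner, complete_space} \<Rightarrow> 'a \<Rightarrow> real"
    and J :: "'h \<Rightarrow> real"
    and K :: "'a \<Rightarrow> 'a \<Rightarrow> real"
  assumes T: "compact T"
    and rkhs: "rkhs_subspace_L2 T val"
    and J_seminorm: "squared_seminorm J"
    and finite_dim: "finite_dim_subspace (null_space J)"
    and K_kernel: "reproducing_kernel T val (orth_complement (null_space J)) (\<bullet>) K"
    and K_continuous: "continuous_on (T \<times> T) (\<lambda>(s, t). K s t)"
    and J_norm: "f \<in> orth_complement (null_space J) \<Longrightarrow> J f = (norm f)\<^sup>2"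
begin

lemma T_meas: "T \<in> sets lebesgue"
  by (rule compact_imp_lebesgue_set[OF T])

lemma val_bounded_linear: "t \<in> T \<Longrightarrow> bounded_linear (\<lambda>f. val f t)"
  using rkhs by (simp add: rkhs_subspace_L2_def)

lemma val_L2: "val f \<in> L2 T"
  using rkhs by (simp add: rkhs_subspace_L2_def)

definition embed_val :: "'h \<Rightarrow> 'a l2" where
  "embed_val f = embed_L2 T (val f)"

lemma embed_eq_zero: "embed_val f = 0 \<Longrightarrow> f = 0"
  using rkhs embed_L2_eq_iff[OF T_meas val_L2 L2_zero, of f] embed_L2_zero[OF T_meas]
  unfolding embed_val_def rkhs_subspace_L2_def by auto

lemma embed_lincomb: "embed_val (a *\<^sub>R f + b *\<^sub>R g) = a *\<^sub>R embed_val f + b *\<^sub>R embed_val g"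
proof -
  have "val (a *\<^sub>R f + b *\<^sub>R g) t = a * val f t + b * val g t" if "t \<in> T" for t
  proof -
    interpret bounded_linear "\<lambda>f. val f t" using that by (rule val_bounded_linear)
    show ?thesis by (simp add: add scaleR)
  qed
  then have "embed_val (a *\<^sub>R f + b *\<^sub>R g) = embed_L2 T (\<lambda>t. a * val f t + b * val g t)"
    unfolding embed_val_def embed_L2_def by (intro arg_cong[of _ _ abs_l2] ext) (simp add: indicator_def)
  then show ?thesis
    using embed_L2_lincomb[OF T_meas val_L2 val_L2] by (simp add: embed_val_def)
qed

lemma embed_linear: "linear embed_val"
  using embed_lincomb[of 1 _ 1] embed_lincomb[of _ _ 0] by (intro linearI) simp_all

lemma norm_embed_le:
  assumes "\<And>t. t \<in> T \<Longrightarrow> \<bar>val f t\<bar> \<le> b" and "b \<ge> 0"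
  shows "norm (embed_val f) \<le> b * sqrt (measure lebesgue T)"
  unfolding embed_val_def norm_embed_L2[OF T_meas val_L2]
  using norm_L2_le_bound[OF T val_L2 assms] .

text \<open>\<open>J\<close> is given as a squared norm on the complement only; the triangle
  inequality for the seminorm, used in both directions, removes the null component
  \<open>f0\<close>.\<close>

lemma J_projection:
  assumes f0: "f0 \<in> null_space J" and f1: "f - f0 \<in> orth_complement (null_space J)"
  shows "J f = (norm (f - f0))\<^sup>2"
proof -
  obtain p where p: "\<And>f g. p (f + g) \<le> p f + p g" "\<And>c f. p (c *\<^sub>R f) = \<bar>c\<bar> * p f" "\<And>f. J f = (p f)\<^sup>2"
    using J_seminorm unfolding squared_seminorm_def seminorm_def by blast
  have "p f0 = 0"
    using f0 p(3)[of f0] by (simp add: null_space_def)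
  then have "p (- f0) = 0"
    using p(2)[of "-1" f0] by simp
  have "p f = p (f - f0)"
    using p(1)[of "f - f0" f0] p(1)[of f "- f0"] \<open>p f0 = 0\<close> \<open>p (- f0) = 0\<close> by simp
  then show ?thesis
    using J_norm[OF f1] p(3) by simp
qed

lemma kernel_representer:
  "t \<in> T \<Longrightarrow> \<exists>h\<in>orth_complement (null_space J).
    (\<forall>s\<in>T. val h s = K s t) \<and> (\<forall>f\<in>orth_complement (null_space J). val f t = f \<bullet> h)"
  using K_kernel unfolding reproducing_kernel_def by blast

text \<open>\<open>K s s - 2 * K s t + K t t\<close> is the squared distance of the representers of
  evaluation at \<open>s\<close> and at \<open>t\<close>. Continuity of \<open>K\<close> thus
  becomes equicontinuity of norm-bounded sets.\<close>

lemma val_diff_bound: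
  assumes f: "f \<in> orth_complement (null_space J)" and st: "s \<in> T" "t \<in> T"
  shows "\<bar>val f s - val f t\<bar> \<le> norm f * sqrt (K s s - 2 * K s t + K t t)"
    and "\<bar>val f t\<bar> \<le> norm f * sqrt (K t t)"
    and "0 \<le> K s s - 2 * K s t + K t t"
proof -
  let ?V = "orth_complement (null_space J)"
  obtain h where h: "h \<in> ?V" "\<And>r. r \<in> T \<Longrightarrow> val h r = K r s" "\<And>f. f \<in> ?V \<Longrightarrow> val f s = f \<bullet> h"
    using kernel_representer[OF st(1)] by blast
  obtain k where k: "k \<in> ?V" "\<And>r. r \<in> T \<Longrightarrow> val k r = K r t" "\<And>f. f \<in> ?V \<Longrightarrow> val f t = f \<bullet> k"
    using kernel_representer[OF st(2)] by blast
  have hk: "(h - k) \<bullet> (h - k) = K s s - 2 * K s t + K t t"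
    using h(2)[OF st(1)] h(3)[OF h(1)] h(3)[OF k(1)] k(2)[OF st(1)] k(2)[OF st(2)] k(3)[OF k(1)]
    by (simp add: inner_diff_left inner_diff_right inner_commute)
  then show "0 \<le> K s s - 2 * K s t + K t t"
    using inner_ge_zero[of "h - k"] by simp
  have "norm (h - k) = sqrt (K s s - 2 * K s t + K t t)"
    by (simp add: norm_eq_sqrt_inner hk)
  moreover have "val f s - val f t = f \<bullet> (h - k)"
    using h(3)[OF f] k(3)[OF f] by (simp add: inner_diff_right)
  ultimately show "\<bar>val f s - val f t\<bar> \<le> norm f * sqrt (K s s - 2 * K s t + K t t)"
    using Cauchy_Schwarz_ineq2[of f "h - k"] by simp
  have "norm k = sqrt (K t t)"
    using k(2)[OF st(2)] k(3)[OF k(1)] by (simp add: norm_eq_sqrt_inner)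
  then show "\<bar>val f t\<bar> \<le> norm f * sqrt (K t t)"
    using Cauchy_Schwarz_ineq2[of f k] k(3)[OF f] by simp
qed

lemma val_orth_bound:
  "\<exists>\<kappa>\<ge>0. \<forall>f\<in>orth_complement (null_space J). \<forall>t\<in>T. \<bar>val f t\<bar> \<le> norm f * \<kappa>"
proof -
  obtain b where b: "b \<ge> 0" "\<And>s t. s \<in> T \<Longrightarrow> t \<in> T \<Longrightarrow> \<bar>K s t\<bar> \<le> b"
    using continuous_kernel_bounded[OF T K_continuous] by blast
  have "\<bar>val f t\<bar> \<le> norm f * sqrt b" if "f \<in> orth_complement (null_space J)" "t \<in> T" for f t
  proof -
    have "norm f * sqrt (K t t) \<le> norm f * sqrt b"
      using b(2)[OF that(2) that(2)] by (intro mult_left_mono real_sqrt_le_mono) auto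
    then show ?thesis
      using val_diff_bound(2)[OF that(1) that(2) that(2)] by linarith
  qed
  then show ?thesis
    using b(1) by (intro exI[of _ "sqrt b"]) auto
qed

lemma convergent_subseq_orth:
  fixes f :: "nat \<Rightarrow> 'h"
  assumes f: "\<And>n. f n \<in> orth_complement (null_space J)" and b: "\<And>n. norm (f n) \<le> b"
  shows "\<exists>r l. strict_mono r \<and> (\<lambda>n. embed_val (f (r n))) \<longlonglongrightarrow> l"
proof -
  obtain \<kappa> where \<kappa>: "\<kappa> \<ge> 0" "\<And>f t. f \<in> orth_complement (null_space J) \<Longrightarrow> t \<in> T \<Longrightarrow> \<bar>val f t\<bar> \<le> norm f * \<kappa>"
    using val_orth_bound by blast
  have "b \<ge> 0" using b[of 0] norm_ge_zero order_trans by blast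
  have bound: "norm (val (f n) t) \<le> b * \<kappa>" if "t \<in> T" for n t
    using \<kappa>(2)[OF f that, of n] mult_right_mono[OF b \<kappa>(1), of n] by simp
  have equicont: "\<exists>d. 0 < d \<and> (\<forall>n y. y \<in> T \<and> norm (x - y) < d \<longrightarrow> norm (val (f n) x - val (f n) y) < e)"
    if "x \<in> T" "0 < e" for x and e :: real
  proof -
    \<comment> \<open>A modulus of continuity common to all \<open>f n\<close>; it vanishes at
      \<open>y = x\<close>.\<close>
    let ?g = "\<lambda>y. b * sqrt (K x x - 2 * K x y + K y y)"
    have "continuous_on T (\<lambda>y. (\<lambda>(s, t). K s t) (y, y))"
      by (intro continuous_on_compose2[OF K_continuous] continuous_intros) auto
    then have "continuous_on T ?g"
      using continuous_on_kernel_section(1)[OF K_continuous \<open>x \<in> T\<close>]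
      by (intro continuous_intros) auto
    then obtain d where d: "d > 0" "\<And>y. y \<in> T \<Longrightarrow> dist y x < d \<Longrightarrow> dist (?g y) (?g x) < e"
      using \<open>x \<in> T\<close> \<open>0 < e\<close> unfolding continuous_on_iff by metis
    have "norm (val (f n) x - val (f n) y) < e" if "y \<in> T" "norm (x - y) < d" for n y
    proof -
      have "norm (val (f n) x - val (f n) y) \<le> norm (f n) * sqrt (K x x - 2 * K x y + K y y)"
        using val_diff_bound(1)[OF f \<open>x \<in> T\<close> \<open>y \<in> T\<close>] by simp
      also have "\<dots> \<le> ?g y"
        using val_diff_bound(3)[OF f \<open>x \<in> T\<close> \<open>y \<in> T\<close>] b[of n] by (intro mult_right_mono) auto
      also have "\<dots> < e"
        using d(2)[OF \<open>y \<in> T\<close>] that by (simp add: dist_norm norm_minus_commute)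
      finally show ?thesis .
    qed
    then show ?thesis using d(1) by blast
  qed
  obtain g r where g: "continuous_on T g" and r: "strict_mono (r :: nat \<Rightarrow> nat)"
    and unif: "\<And>e. 0 < e \<Longrightarrow> \<exists>N. \<forall>n x. n \<ge> N \<and> x \<in> T \<longrightarrow> norm (val (f (r n)) x - g x) < e"
    by (rule Arzela_Ascoli[OF T bound equicont]) (assumption | rule that)+
  have gL2: "g \<in> L2 T" by (rule continuous_L2[OF T g])
  \<comment> \<open>Uniform convergence on a set of finite measure is L2 convergence. The limit
    \<open>g\<close> is not claimed to be the value function of an element of
    \<open>'h\<close>.\<close>
  have "(\<lambda>n. embed_val (f (r n))) \<longlonglongrightarrow> embed_L2 T g"
  proof (rule metric_LIMSEQ_I)
    fix e :: real assume "e > 0"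
    define m where "m = sqrt (measure lebesgue T)"
    have "m \<ge> 0" unfolding m_def by simp
    define d where "d = e / (m + 1)"
    have "d > 0" unfolding d_def using \<open>e > 0\<close> \<open>m \<ge> 0\<close> by simp
    then obtain N where N: "\<And>n x. n \<ge> N \<Longrightarrow> x \<in> T \<Longrightarrow> norm (val (f (r n)) x - g x) < d"
      using unif by blast
    have "dist (embed_val (f (r n))) (embed_L2 T g) < e" if "n \<ge> N" for n
    proof -
      have "dist (embed_val (f (r n))) (embed_L2 T g) = norm_L2 T (\<lambda>t. val (f (r n)) t - g t)"
        unfolding embed_val_def dist_norm
        by (simp add: embed_L2_diff[OF T_meas, symmetric] norm_embed_L2[OF T_meas] val_L2 gL2
            L2_diff)
      also have "\<dots> \<le> d * m"
        unfolding m_def using N[OF that] \<open>d > 0\<close>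
        by (intro norm_L2_le_bound[OF T] L2_diff val_L2 gL2) (auto intro: less_imp_le)
      also have "\<dots> < d * (m + 1)" using \<open>d > 0\<close> by simp
      also have "\<dots> = e" unfolding d_def using \<open>m \<ge> 0\<close> by simp
      finally show ?thesis .
    qed
    then show "\<exists>N. \<forall>n\<ge>N. dist (embed_val (f (r n))) (embed_L2 T g) < e" by blast
  qed
  then show ?thesis using r by blast
qed

text \<open>\<open>P\<close> is the projection onto the null space. \<open>D t\<close> bounds the
  norm of evaluation at \<open>t\<close>; its square integrability is what later makes the trace
  finite.\<close>

lemma compact_decomposition:
  "\<exists>P D. compact_operator P \<and> (\<forall>f. P f \<in> null_space J) \<and> (\<forall>f. J f = (norm (f - P f))\<^sup>2) \<and>
    compact_operator embed_val \<and> D \<in> L2 T \<and> (\<forall>f. \<forall>t\<in>T. \<bar>val f t\<bar> \<le> norm f * D t)"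
proof -
  let ?V = "orth_complement (null_space J)"
  obtain E \<phi> where E: "finite E" and \<phi>: "\<And>e. e \<in> E \<Longrightarrow> bounded_linear (\<phi> e)"
    and null: "\<And>f. (\<Sum>e\<in>E. \<phi> e f *\<^sub>R e) \<in> null_space J"
    and orth: "\<And>f. f - (\<Sum>e\<in>E. \<phi> e f *\<^sub>R e) \<in> ?V"
    using finite_dim_projection[OF finite_dim] by blast
  define P where "P f = (\<Sum>e\<in>E. \<phi> e f *\<^sub>R e)" for f
  have P: "compact_operator P"
    unfolding P_def by (intro compact_operator_sum E compact_operator_rank_one \<phi>)
  then have Q_bl: "bounded_linear (\<lambda>f. f - P f)"
    by (intro bounded_linear_sub bounded_linear_ident compact_operator_bounded_linear)
  obtain q where q: "q \<ge> 0" "\<And>f. norm (f - P f) \<le> norm f * q"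
    using bounded_linear.nonneg_bounded[OF Q_bl] by blast
  obtain \<kappa> where \<kappa>: "\<kappa> \<ge> 0" "\<And>f t. f \<in> ?V \<Longrightarrow> t \<in> T \<Longrightarrow> \<bar>val f t\<bar> \<le> norm f * \<kappa>"
    using val_orth_bound by blast
  have val_Q: "\<bar>val (f - P f) t\<bar> \<le> norm f * (q * \<kappa>)" if "t \<in> T" for f t
  proof -
    have "\<bar>val (f - P f) t\<bar> \<le> norm (f - P f) * \<kappa>"
      using \<kappa>(2)[OF _ that] orth unfolding P_def by blast
    also have "\<dots> \<le> norm f * q * \<kappa>"
      using q(2) \<kappa>(1) by (rule mult_right_mono)
    finally show ?thesis by (simp add: mult.assoc)
  qed
  have embed_P: "embed_val (P f) = (\<Sum>e\<in>E. \<phi> e f *\<^sub>R embed_val e)" for f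
    unfolding P_def by (simp add: linear_sum[OF embed_linear] linear_scale[OF embed_linear])
  have compact_embed_P: "compact_operator (\<lambda>f. embed_val (P f))"
    unfolding embed_P by (intro compact_operator_sum E compact_operator_rank_one \<phi>)
  have compact_embed_Q: "compact_operator (\<lambda>f. embed_val (f - P f))"
  proof (rule compact_operatorI)
    have "norm (embed_val (f - P f)) \<le> norm f * (q * \<kappa> * sqrt (measure lebesgue T))" for f
      using norm_embed_le[OF val_Q, of f] q(1) \<kappa>(1) by (simp add: mult.assoc)
    moreover have "linear (\<lambda>f. embed_val (f - P f))"
      using linear_compose[OF bounded_linear.linear[OF Q_bl] embed_linear] by (simp add: o_def)
    ultimately show "bounded_linear (\<lambda>f. embed_val (f - P f))"
      by (simp add: bounded_linear_def bounded_linear_axioms_def) blast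
  next
    fix x :: "nat \<Rightarrow> 'h" and b assume b: "\<And>n. norm (x n) \<le> b"
    have "norm (x n - P (x n)) \<le> b * q" for n
      using q(2)[of "x n"] mult_right_mono[OF b q(1), of n] by linarith
    moreover have "x n - P (x n) \<in> ?V" for n
      using orth unfolding P_def by blast
    ultimately show "\<exists>r l. strict_mono r \<and> (\<lambda>n. embed_val (x (r n) - P (x (r n)))) \<longlonglongrightarrow> l"
      using convergent_subseq_orth[of "\<lambda>n. x n - P (x n)" "b * q"] by simp
  qed
  have "(\<lambda>f. embed_val (P f) + embed_val (f - P f)) = embed_val"
    by (simp add: fun_eq_iff linear_diff[OF embed_linear])
  then have "compact_operator embed_val"
    using compact_operator_add[OF compact_embed_P compact_embed_Q] by simp
  moreover have "\<forall>f. P f \<in> null_space J"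
    using null unfolding P_def by blast
  moreover have "\<forall>f. J f = (norm (f - P f))\<^sup>2"
    using J_projection null orth unfolding P_def by blast
  moreover define c where "c e = onorm (\<phi> e)" for e
  define D where "D t = (\<Sum>e\<in>E. c e * \<bar>val e t\<bar>) + q * \<kappa>" for t
  have abs_L2: "(\<lambda>t. \<bar>f t\<bar>) \<in> L2 T" if "f \<in> L2 T" for f :: "'a \<Rightarrow> real"
    using L2_square_integrable[OF that] L2_measurable[OF that] by (intro L2I) auto
  have "(\<lambda>t. \<Sum>e\<in>E. c e * \<bar>val e t\<bar>) \<in> L2 T"
    using E by (induction E rule: finite_induct) (auto intro!: L2_zero L2_add L2_scale abs_L2 val_L2)
  then have "D \<in> L2 T"
    unfolding D_def by (intro L2_add continuous_L2[OF T continuous_on_const])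
  moreover have "\<bar>val f t\<bar> \<le> norm f * D t" if "t \<in> T" for f t
  proof -
    interpret bounded_linear "\<lambda>f. val f t" using that by (rule val_bounded_linear)
    have "\<bar>val (P f) t\<bar> \<le> (\<Sum>e\<in>E. \<bar>\<phi> e f * val e t\<bar>)"
      unfolding P_def by (simp add: sum scaleR)
    also have "\<dots> \<le> (\<Sum>e\<in>E. norm f * (c e * \<bar>val e t\<bar>))"
    proof (rule sum_mono)
      fix e assume "e \<in> E"
      have "\<bar>\<phi> e f\<bar> \<le> c e * norm f"
        using onorm[OF \<phi>[OF \<open>e \<in> E\<close>], of f] unfolding c_def by simp
      then have "\<bar>\<phi> e f\<bar> * \<bar>val e t\<bar> \<le> (c e * norm f) * \<bar>val e t\<bar>"
        by (rule mult_right_mono) simp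
      then show "\<bar>\<phi> e f * val e t\<bar> \<le> norm f * (c e * \<bar>val e t\<bar>)"
        by (simp add: abs_mult ac_simps)
    qed
    finally have "\<bar>val (P f) t\<bar> \<le> norm f * (\<Sum>e\<in>E. c e * \<bar>val e t\<bar>)"
      by (simp add: sum_distrib_left)
    moreover have "val f t = val (P f) t + val (f - P f) t"
      using add[of "P f" "f - P f"] by simp
    ultimately show ?thesis
      using val_Q[OF that, of f] unfolding D_def by (simp add: distrib_left)
  qed
  ultimately show ?thesis
    using P by (intro exI[of _ P] exI[of _ D]) blast
qed

end

theorem theorem3:
  fixes T :: "'a::euclidean_space set"
    and val :: "'h::{real_inner, complete_space} \<Rightarrow> 'a \<Rightarrow> real"
    and J :: "'h \<Rightarrow> real"
    and M :: "'w measure" and X :: "'w \<Rightarrow> 'a \<Rightarrow> real"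
    and K C R :: "'a \<Rightarrow> 'a \<Rightarrow> real"
    and sqrtR :: "('a \<Rightarrow> real) \<Rightarrow> 'a \<Rightarrow> real"
    and \<nu> \<gamma> fc :: "nat \<Rightarrow> real" and \<zeta> :: "nat \<Rightarrow> 'a \<Rightarrow> real"
    and \<omega> :: "nat \<Rightarrow> 'h" and f :: 'h
  assumes "compact T"
    and "rkhs_subspace_L2 T val"
    and "squared_seminorm J"
    and "finite_dim_subspace (null_space J)"
    and "reproducing_kernel T val (orth_complement (null_space J)) (\<bullet>) K"
    and "continuous_L2_kernel T K"
    and "\<And>f1. f1 \<in> orth_complement (null_space J) \<Longrightarrow> J f1 = (norm f1)\<^sup>2"
    and "prob_space M"
    and "square_integrable_process T M X"
    and "C = covariance M X"
    and "continuous_L2_kernel T C"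
    and "\<And>f0. f0 \<in> null_space J \<Longrightarrow> f0 \<noteq> 0 \<Longrightarrow> \<not> eq_L2 T (integral_op T C (val f0)) (\<lambda>_. 0)"
    and "reproducing_kernel T val UNIV (inner_R T val C J) R"
    and "is_sqrt_op T (integral_op T R) sqrtR"
    and "eigensystem_L2 T (\<lambda>g. sqrtR (integral_op T C (sqrtR g))) \<nu> \<zeta>"
    \<comment> \<open>needed for \<open>\<nu> k powr (- 1 / 2)\<close> to make sense\<close>
    and "\<And>k. \<nu> k > 0"
    and "\<And>k. \<omega> k = of_L2 T val (\<lambda>t. \<nu> k powr (- 1 / 2) * sqrtR (\<zeta> k) t)"
    and "\<And>k. fc k = \<nu> k * inner_R T val C J f (\<omega> k)"
    \<comment> \<open>if \<open>\<nu> k = 1\<close>, read \<open>\<gamma> k = \<infinity>\<close> and \<open>1 / \<gamma> k = 0\<close>; with \<open>inverse 0 = 0\<close> the term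
        \<open>inverse (\<gamma> k)\<close> has the right value in this case too\<close>
    and "\<And>k. \<gamma> k = inverse (inverse (\<nu> k) - 1)"
  shows "(\<forall>k. eq_L2 T (val (\<omega> k)) (\<lambda>t. \<nu> k powr (- 1 / 2) * sqrtR (\<zeta> k) t)) \<and>
    (\<forall>t\<in>T. summable (\<lambda>k. \<bar>fc k * val (\<omega> k) t\<bar>) \<and> (\<lambda>k. fc k * val (\<omega> k) t) sums val f t) \<and>
    summable (\<lambda>k. norm_L2 T (\<lambda>t. fc k * val (\<omega> k) t)) \<and>
    (\<lambda>k. fc k *\<^sub>R \<omega> k) sums f \<and>
    (\<lambda>k. (1 + inverse (\<gamma> k)) * (fc k)\<^sup>2) sums inner_R T val C J f f \<and>
    (\<lambda>k. (fc k)\<^sup>2) sums inner_L2 T (integral_op T C (val f)) (val f) \<and>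
    J f = inner_R T val C J f f - inner_L2 T (integral_op T C (val f)) (val f) \<and>
    (\<lambda>k. inverse (\<gamma> k) * (fc k)\<^sup>2) sums J f"
proof -
  interpret penalized_rkhs T val J K
    using assms(1-7) by unfold_locales (auto simp: continuous_L2_kernel_def)

  \<comment> \<open>The covariance operator on \<open>l2\<close>\<close>
  have C_cont: "continuous_on (T \<times> T) (\<lambda>(s, t). C s t)"
    using assms(11) by (simp add: continuous_L2_kernel_def)
  have C_bl: "bounded_linear_L2 T (integral_op T C)"
    by (rule bounded_linear_L2_integral_op[OF T C_cont])
  have C_L2: "integral_op T C g \<in> L2 T" if "g \<in> L2 T" for g
    using C_bl that unfolding bounded_linear_L2_def by blast
  define Cl where "Cl = lift_L2 T (integral_op T C)"
  have Cl_bl: "bounded_linear Cl"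
    unfolding Cl_def by (rule lift_L2_bounded_linear[OF T_meas C_bl])
  obtain Z where Z: "\<And>g h. g \<in> L2 T \<Longrightarrow> h \<in> L2 T \<Longrightarrow>
      inner_L2 T (integral_op T C g) h = (LINT w|M. Z g w * Z h w)"
    using inner_covariance_op[OF T assms(8,9)] C_cont unfolding assms(10) by blast
  have Cl_inner: "Cl x \<bullet> y = (LINT w|M. Z (rep_l2 x) w * Z (rep_l2 y) w)" for x y
    unfolding Cl_def lift_L2_def
    by (simp add: inner_embed_L2_left[OF T_meas] C_L2 rep_l2_L2_on[OF T_meas] Z)
  have Cl_selfadj: "Cl x \<bullet> y = x \<bullet> Cl y" for x y
    using Cl_inner[of x y] Cl_inner[of y x] by (simp add: mult.commute inner_commute)
  have Cl_psd: "Cl x \<bullet> x \<ge> 0" for x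
    unfolding Cl_inner by simp
  have Cl_definite: "Cl x = 0" if "Cl x \<bullet> x = 0" for x
    using psd_form_zero[OF Cl_bl Cl_selfadj Cl_psd that] .

  \<comment> \<open>The form of the R norm and its coercivity\<close>
  obtain P D where P: "compact_operator P" "\<And>f. P f \<in> null_space J"
    and J: "\<And>f. J f = (norm (f - P f))\<^sup>2"
    and embed_compact: "compact_operator embed_val" and D: "D \<in> L2 T"
    and val_le: "\<And>f t. t \<in> T \<Longrightarrow> \<bar>val f t\<bar> \<le> norm f * D t"
    using compact_decomposition by blast
  have embed_bl: "bounded_linear embed_val"
    by (rule compact_operator_bounded_linear[OF embed_compact])
  have P_bl: "bounded_linear P"
    by (rule compact_operator_bounded_linear[OF P(1)])
  \<comment> \<open>The second summand polarises \<open>J\<close>, which is the squared norm of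
    \<open>f - P f\<close>; bilinearity is thus built in, whereas \<open>inner_R\<close> is given by
    polarisation of a quadratic form.\<close>
  define B where "B f g = Cl (embed_val f) \<bullet> embed_val g + (f - P f) \<bullet> (g - P g)" for f g
  have B: "bounded_bilinear B"
  proof -
    have "bounded_bilinear (\<lambda>f g. Cl (embed_val f) \<bullet> embed_val g)"
      by (rule bounded_bilinear.comp[OF bounded_bilinear_inner bounded_linear_compose[OF Cl_bl embed_bl] embed_bl])
    moreover have "bounded_bilinear (\<lambda>f g. (f - P f) \<bullet> (g - P g))"
      by (intro bounded_bilinear.comp[OF bounded_bilinear_inner] bounded_linear_sub bounded_linear_ident P_bl)
    ultimately show ?thesis
      unfolding B_def by (rule bounded_bilinear_add)
  qed
  interpret B: bounded_bilinear B by (fact B)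
  have C_form: "inner_L2 T (integral_op T C (val f)) (val f) = Cl (embed_val f) \<bullet> embed_val f" for f
    unfolding Cl_def embed_val_def
    by (simp add: lift_L2_embed[OF T_meas C_bl val_L2] inner_embed_L2[OF T_meas] C_L2 val_L2)
  have quad: "quad_R T val C J f = B f f" for f
    unfolding quad_R_def C_form B_def J by (simp add: power2_norm_eq_inner)
  have B_sym: "B f g = B g f" for f g
    unfolding B_def Cl_selfadj[of "embed_val f" "embed_val g"] by (simp add: inner_commute)
  have inner_R: "inner_R T val C J f g = B f g" for f g
    unfolding inner_R_def quad
    by (simp add: B.add_left B.add_right B.diff_left B.diff_right B_sym[of g f])
  have B_lower: "(norm (f - P f))\<^sup>2 \<le> B f f" for f
    unfolding B_def using Cl_psd[of "embed_val f"] by (simp add: power2_norm_eq_inner)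
  have B_definite: "f = 0" if "B f f = 0" for f
  proof (rule ccontr)
    assume "f \<noteq> 0"
    have "(norm (f - P f))\<^sup>2 \<le> 0" using B_lower[of f] that by simp
    then have "f = P f" by simp
    then have "f \<in> null_space J" using P(2)[of f] by simp
    have "Cl (embed_val f) \<bullet> embed_val f = 0"
      using that \<open>f = P f\<close> unfolding B_def by simp
    then have "embed_L2 T (integral_op T C (val f)) = embed_L2 T (\<lambda>t. 0)"
      using Cl_definite[of "embed_val f"] unfolding Cl_def embed_val_def
      by (simp add: lift_L2_embed[OF T_meas C_bl val_L2] embed_L2_zero[OF T_meas])
    then show False
      using assms(12)[OF \<open>f \<in> null_space J\<close> \<open>f \<noteq> 0\<close>]
      by (simp add: embed_L2_eq_iff[OF T_meas C_L2[OF val_L2] L2_zero])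
  qed
  obtain \<alpha> where \<alpha>: "\<alpha> > 0" "\<And>f. \<alpha> * (norm f)\<^sup>2 \<le> B f f"
    using coercive_of_compact_projection[OF B P(1) B_lower B_definite] by blast
  interpret B: coercive_form B \<alpha>
    by unfold_locales (use \<alpha> B_sym in auto)

  \<comment> \<open>The kernel operator and its square root\<close>
  obtain adj where adj: "\<And>f g. B f (adj g) = embed_val f \<bullet> g"
    using B.exists_adjoint[OF embed_bl] by blast
  have R_repr: "\<exists>h. (\<forall>s\<in>T. val h s = R s t) \<and> (\<forall>f. val f t = B f h)" if "t \<in> T" for t
    using assms(13) that unfolding reproducing_kernel_def inner_R by blast
  \<comment> \<open>Pointwise on \<open>T\<close>, integration against \<open>R\<close> is
    \<open>adj\<close> followed by evaluation. The representers at \<open>s\<close> and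
    \<open>t\<close> and symmetry of \<open>B\<close> show that row \<open>s\<close> of the kernel
    is the function \<open>val h\<close>.\<close>
  have R_op: "integral_op T R (rep_l2 x) s = val (adj x) s" if s: "s \<in> T" for x s
  proof -
    obtain h where h: "\<And>r. r \<in> T \<Longrightarrow> val h r = R r s" "\<And>f. val f s = B f h"
      using R_repr[OF s] by blast
    have "R s t = val h t" if t: "t \<in> T" for t
    proof -
      obtain k where k: "\<And>r. r \<in> T \<Longrightarrow> val k r = R r t" "\<And>f. val f t = B f k"
        using R_repr[OF t] by blast
      have "R s t = B k h" using k(1)[OF s] h(2)[of k] by simp
      also have "\<dots> = val h t" unfolding k(2) by (rule B_sym)
      finally show ?thesis .
    qed
    then have "integral_op T R (rep_l2 x) s = inner_L2 T (val h) (rep_l2 x)"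
      unfolding integral_op_def inner_L2_def by (intro Bochner_Integration.integral_cong) auto
    also have "\<dots> = embed_val h \<bullet> x"
      unfolding embed_val_def by (simp add: inner_embed_L2_left[OF T_meas val_L2])
    also have "\<dots> = val (adj x) s"
      unfolding h(2) adj[symmetric] by (rule B_sym)
    finally show ?thesis .
  qed
  have S_bl2: "bounded_linear_L2 T sqrtR"
    using assms(14) unfolding is_sqrt_op_def by blast
  have S_L2: "sqrtR g \<in> L2 T" if "g \<in> L2 T" for g
    using S_bl2 that unfolding bounded_linear_L2_def by blast
  define S where "S = lift_L2 T sqrtR"
  have S_bl: "bounded_linear S"
    unfolding S_def by (rule lift_L2_bounded_linear[OF T_meas S_bl2])
  interpret S: bounded_linear S by (fact S_bl)
  have S_embed: "S (embed_L2 T g) = embed_L2 T (sqrtR g)" if "g \<in> L2 T" for g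
    unfolding S_def by (rule lift_L2_embed[OF T_meas S_bl2 that])
  have S_rep: "S (embed_L2 T (rep_l2 x)) = S x" for x
    unfolding S_embed[OF rep_l2_L2_on[OF T_meas]] by (simp add: S_def lift_L2_def)
  have S_sqrt: "S x = sqrt \<rho> *\<^sub>R x" if \<rho>: "\<rho> \<ge> 0" and eig: "embed_val (adj x) = \<rho> *\<^sub>R x" for \<rho> x
  proof -
    have g: "rep_l2 x \<in> L2 T" by (rule rep_l2_L2_on[OF T_meas])
    \<comment> \<open>For \<open>\<rho> = 0\<close> the vector \<open>x\<close> may be nonzero off
      \<open>T\<close>; only its multiple by \<open>\<rho>\<close> is compared with the restriction
      to \<open>T\<close>.\<close>
    have \<rho>x: "\<rho> *\<^sub>R x = \<rho> *\<^sub>R embed_L2 T (rep_l2 x)"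
      using embed_rep_of_range[OF T_meas val_L2] eig unfolding embed_val_def by metis
    have "embed_L2 T (val (adj x)) = embed_L2 T (\<lambda>t. \<rho> * rep_l2 x t)"
      using eig \<rho>x unfolding embed_val_def by (simp add: embed_L2_scale[OF T_meas g])
    then have "eq_L2 T (val (adj x)) (\<lambda>t. \<rho> * rep_l2 x t)"
      using embed_L2_eq_iff[OF T_meas val_L2 L2_scale[OF g]] by blast
    moreover have "eq_L2 T (integral_op T R (rep_l2 x)) (val (adj x))"
      using R_op unfolding eq_L2_def by (intro AE_I2) simp
    ultimately have "eq_L2 T (integral_op T R (rep_l2 x)) (\<lambda>t. \<rho> * rep_l2 x t)"
      using eq_L2_trans by blast
    then have "eq_L2 T (sqrtR (rep_l2 x)) (\<lambda>t. sqrt \<rho> * rep_l2 x t)"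
      using assms(14) g \<rho> unfolding is_sqrt_op_def by blast
    then have "S x = sqrt \<rho> *\<^sub>R embed_L2 T (rep_l2 x)"
      unfolding S_def lift_L2_def
      using embed_L2_eq_iff[OF T_meas S_L2[OF g] L2_scale[OF g]] embed_L2_scale[OF T_meas g] by simp
    then show ?thesis
      using \<rho>x by (cases "\<rho> = 0") auto
  qed

  \<comment> \<open>Transfer of the eigensystem\<close>
  have \<zeta>_L2: "\<zeta> k \<in> L2 T" for k
    using assms(15) unfolding eigensystem_L2_def by blast
  define z where "z k = embed_L2 T (\<zeta> k)" for k
  have z_orth: "z j \<bullet> z k = (if j = k then 1 else 0)" for j k
    using assms(15) unfolding z_def eigensystem_L2_def
    by (simp add: inner_embed_L2[OF T_meas \<zeta>_L2 \<zeta>_L2])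
  have SCS: "S (Cl (S (embed_L2 T g))) = embed_L2 T (sqrtR (integral_op T C (sqrtR g)))"
    if "g \<in> L2 T" for g
    using that unfolding Cl_def by (simp add: S_embed lift_L2_embed[OF T_meas C_bl] S_L2 C_L2)
  have SCS_L2: "sqrtR (integral_op T C (sqrtR g)) \<in> L2 T" if "g \<in> L2 T" for g
    using that by (intro S_L2 C_L2)
  have z_eigen: "S (Cl (S (z k))) = \<nu> k *\<^sub>R z k" for k
    using assms(15) unfolding z_def SCS[OF \<zeta>_L2] eigensystem_L2_def
    by (simp add: embed_L2_scale[OF T_meas \<zeta>_L2, symmetric] embed_L2_eq_iff[OF T_meas] SCS_L2 \<zeta>_L2 L2_scale)
  have complete: "S x = 0" if eig: "S (Cl (S x)) = c *\<^sub>R x" and orth: "\<And>k. x \<bullet> z k = 0" for x c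
  proof -
    let ?g = "rep_l2 x"
    have g: "?g \<in> L2 T" by (rule rep_l2_L2_on[OF T_meas])
    have Ag: "embed_L2 T (sqrtR (integral_op T C (sqrtR ?g))) = c *\<^sub>R x"
      unfolding SCS[OF g, symmetric] S_rep by (rule eig)
    then have "c *\<^sub>R x = c *\<^sub>R embed_L2 T ?g"
      by (intro embed_rep_of_range[OF T_meas SCS_L2[OF g]]) simp
    then have "eq_L2 T (sqrtR (integral_op T C (sqrtR ?g))) (\<lambda>t. c * ?g t)"
      using Ag by (simp add: embed_L2_eq_iff[OF T_meas SCS_L2[OF g] L2_scale[OF g], symmetric]
          embed_L2_scale[OF T_meas g])
    moreover have "inner_L2 T ?g (\<zeta> k) = 0" for k
      using orth[of k] inner_embed_L2_left[OF T_meas \<zeta>_L2, of k x]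
      unfolding z_def by (simp add: inner_commute inner_L2_def mult.commute)
    ultimately have "eq_L2 T ?g (\<lambda>_. 0)"
      using assms(15) g unfolding eigensystem_L2_def by blast
    then have "embed_L2 T ?g = 0"
      using embed_L2_eq_iff[OF T_meas g L2_zero] embed_L2_zero[OF T_meas] by simp
    then show ?thesis
      using S_rep[of x] by (simp add: S.zero)
  qed
  interpret F: factorized_eigensystem B \<alpha> embed_val adj Cl S \<nu> z
    by (rule factorized_eigensystem.intro[OF B.coercive_form_axioms factorized_eigensystem_axioms.intro])
      (fact embed_compact embed_eq_zero adj Cl_bl Cl_selfadj Cl_definite S_bl S_sqrt z_orth z_eigen
        assms(16) complete)+
  note \<nu>_pos = assms(16)

  \<comment> \<open>Identification of \<open>\<omega>\<close> and the coefficients\<close>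
  have w: "eq_L2 T (val (\<nu> k powr (- 1 / 2) *\<^sub>R F.u k)) (\<lambda>t. \<nu> k powr (- 1 / 2) * sqrtR (\<zeta> k) t)" for k
  proof -
    have "embed_val (\<nu> k powr (- 1 / 2) *\<^sub>R F.u k) = \<nu> k powr (- 1 / 2) *\<^sub>R embed_L2 T (sqrtR (\<zeta> k))"
      by (simp add: F.iota.scaleR F.embedding_u z_def S_embed \<zeta>_L2)
    then show ?thesis
      unfolding embed_val_def
      by (simp add: embed_L2_scale[OF T_meas S_L2[OF \<zeta>_L2], symmetric]
          embed_L2_eq_iff[OF T_meas val_L2 L2_scale[OF S_L2[OF \<zeta>_L2]]])
  qed
  have \<omega>: "\<omega> k = \<nu> k powr (- 1 / 2) *\<^sub>R F.u k" for k
    unfolding assms(17) of_L2_def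
  proof (rule the_equality, rule w)
    fix h assume h: "eq_L2 T (val h) (\<lambda>t. \<nu> k powr (- 1 / 2) * sqrtR (\<zeta> k) t)"
    have "embed_val h = embed_val (\<nu> k powr (- 1 / 2) *\<^sub>R F.u k)"
      unfolding embed_val_def embed_L2_eq_iff[OF T_meas val_L2 val_L2]
      using eq_L2_trans[OF h eq_L2_sym[OF w]] .
    then have "embed_val (h - \<nu> k powr (- 1 / 2) *\<^sub>R F.u k) = 0"
      by (simp add: F.iota.diff)
    then show "h = \<nu> k powr (- 1 / 2) *\<^sub>R F.u k"
      using embed_eq_zero by force
  qed
  define b where "b k = B f (F.u k)" for k
  \<comment> \<open>The powers of \<open>\<nu> k\<close> cancel in
    \<open>fc k *\<^sub>R \<omega> k\<close>, so the series is the orthonormal expansion along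
    \<open>F.u\<close>.\<close>
  have powr_half: "\<nu> k * \<nu> k powr (- 1 / 2) * \<nu> k powr (- 1 / 2) = 1" for k
    using \<nu>_pos[of k] by (simp add: powr_minus powr_half_sqrt field_simps flip: powr_add)
  have fc: "fc k = \<nu> k * \<nu> k powr (- 1 / 2) * b k" for k
    unfolding assms(18) inner_R \<omega> b_def by (simp add: B.scaleR_right)
  have fc_\<omega>: "fc k *\<^sub>R \<omega> k = b k *\<^sub>R F.u k" for k
    using powr_half[of k] unfolding fc \<omega> by (simp add: ac_simps)
  have fc2: "(fc k)\<^sup>2 = \<nu> k * (b k)\<^sup>2" for k
    using powr_half[of k] unfolding fc by (simp add: power2_eq_square ac_simps)
  have fc_val: "fc k * val (\<omega> k) t = b k * val (F.u k) t" if "t \<in> T" for k t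
  proof -
    interpret bounded_linear "\<lambda>f. val f t" using that by (rule val_bounded_linear)
    show ?thesis using fc_\<omega>[of k] scaleR by (metis real_scaleR_def)
  qed
  have b2_summable: "summable (\<lambda>k. (b k)\<^sup>2)"
    unfolding b_def by (rule B.Bessel_summable[OF F.u_orth])
  have abs_le: "\<bar>x * y\<bar> \<le> x\<^sup>2 + y\<^sup>2" for x y :: real
    using sum_squares_bound[of "\<bar>x\<bar>" "\<bar>y\<bar>"] zero_le_power2[of x] zero_le_power2[of y]
    unfolding abs_mult power2_abs by linarith
  have f_sums: "(\<lambda>k. fc k *\<^sub>R \<omega> k) sums f"
    unfolding fc_\<omega> b_def by (rule F.expansion)

  \<comment> \<open>Absolute convergence, pointwise and in L2\<close>
  have pointwise: "summable (\<lambda>k. \<bar>fc k * val (\<omega> k) t\<bar>) \<and> (\<lambda>k. fc k * val (\<omega> k) t) sums val f t"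
    if t: "t \<in> T" for t
  proof
    interpret val_t: bounded_linear "\<lambda>f. val f t" using t by (rule val_bounded_linear)
    show "(\<lambda>k. fc k * val (\<omega> k) t) sums val f t"
      using val_t.sums[OF f_sums] by (simp add: val_t.scaleR)
    \<comment> \<open>With the representer \<open>h\<close> of evaluation at \<open>t\<close>, the
      values of \<open>F.u k\<close> at \<open>t\<close> are the coefficients of \<open>h\<close>;
      the series is a product of two square-summable sequences.\<close>
    obtain h where h: "\<And>f. val f t = B f h"
      using R_repr[OF t] by blast
    have "summable (\<lambda>k. (B h (F.u k))\<^sup>2)"
      by (rule B.Bessel_summable[OF F.u_orth])
    then have "summable (\<lambda>k. (b k)\<^sup>2 + (val (F.u k) t)\<^sup>2)"
      using b2_summable by (simp add: h B_sym summable_add)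
    then show "summable (\<lambda>k. \<bar>fc k * val (\<omega> k) t\<bar>)"
      unfolding fc_val[OF t] by (rule summable_comparison_test'[where N = 0]) (simp add: abs_le)
  qed

  have u_L2_summable: "summable (\<lambda>k. (norm (embed_val (F.u k)))\<^sup>2)"
  proof (rule summableI_nonneg_bounded)
    fix n
    have "(\<Sum>k<n. (norm (embed_val (F.u k)))\<^sup>2) = (\<Sum>k<n. (LINT t|lebesgue_on T. (val (F.u k) t)\<^sup>2))"
      unfolding embed_val_def power2_norm_eq_inner inner_embed_L2[OF T_meas val_L2 val_L2] inner_L2_self ..
    also have "\<dots> = (LINT t|lebesgue_on T. (\<Sum>k<n. (val (F.u k) t)\<^sup>2))"
      by (intro Bochner_Integration.integral_sum[symmetric] L2_square_integrable val_L2)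
    also have "\<dots> \<le> (LINT t|lebesgue_on T. (D t)\<^sup>2 / \<alpha>)"
    proof (intro integral_mono Bochner_Integration.integrable_sum L2_square_integrable val_L2)
      show "integrable (lebesgue_on T) (\<lambda>t. (D t)\<^sup>2 / \<alpha>)"
        using L2_square_integrable[OF D] by simp
      fix t assume "t \<in> space (lebesgue_on T)"
      then have t: "t \<in> T" by simp
      \<comment> \<open>\<open>B h h\<close> is the value at \<open>t\<close> of \<open>h\<close>
        itself, the diagonal of the kernel. It is at most \<open>norm h * D t\<close>, and
        coercivity bounds \<open>norm h\<close> by the square root of
        \<open>B h h / \<alpha>\<close>; solving for \<open>B h h\<close> yields the majorant, which
        is integrable because \<open>D\<close> is in \<open>L2 T\<close>.\<close>
      obtain h where h: "\<And>f. val f t = B f h"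
        using R_repr[OF t] by blast
      have le: "B h h \<le> norm h * D t"
        using val_le[OF t, of h] unfolding h by linarith
      have "(B h h)\<^sup>2 \<le> (norm h * D t)\<^sup>2"
        using le B.form_nonneg[of h] by (intro power_mono)
      also have "\<dots> \<le> B h h * ((D t)\<^sup>2 / \<alpha>)"
      proof -
        have "(norm h)\<^sup>2 \<le> B h h / \<alpha>"
          using \<alpha> by (simp add: pos_le_divide_eq mult.commute)
        then have "(norm h)\<^sup>2 * (D t)\<^sup>2 \<le> B h h / \<alpha> * (D t)\<^sup>2"
          by (rule mult_right_mono) simp
        then show ?thesis by (simp add: power_mult_distrib)
      qed
      finally have "B h h * B h h \<le> B h h * ((D t)\<^sup>2 / \<alpha>)"
        by (simp add: power2_eq_square)
      moreover have "(D t)\<^sup>2 / \<alpha> \<ge> 0" using \<alpha>(1) by simp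
      ultimately have "B h h \<le> (D t)\<^sup>2 / \<alpha>"
        using B.form_nonneg[of h] by (metis mult_left_le_imp_le order_le_less)
      moreover have "(\<Sum>k<n. (val (F.u k) t)\<^sup>2) \<le> B h h"
        using B.Bessel[OF F.u_orth, of h n] by (simp add: h B_sym[of h "F.u _"])
      ultimately show "(\<Sum>k<n. (val (F.u k) t)\<^sup>2) \<le> (D t)\<^sup>2 / \<alpha>" by linarith
    qed
    finally show "(\<Sum>k<n. (norm (embed_val (F.u k)))\<^sup>2) \<le> (LINT t|lebesgue_on T. (D t)\<^sup>2 / \<alpha>)" .
  qed simp

  have norm_summable: "summable (\<lambda>k. norm_L2 T (\<lambda>t. fc k * val (\<omega> k) t))"
  proof (rule summable_comparison_test'[where N = 0])
    show "summable (\<lambda>k. (b k)\<^sup>2 + (norm (embed_val (F.u k)))\<^sup>2)"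
      using b2_summable u_L2_summable by (rule summable_add)
    fix k
    have "norm_L2 T (\<lambda>t. fc k * val (\<omega> k) t) = norm (embed_L2 T (\<lambda>t. fc k * val (\<omega> k) t))"
      by (rule norm_embed_L2[OF T_meas L2_scale[OF val_L2], symmetric])
    also have "\<dots> = norm (fc k *\<^sub>R embed_val (\<omega> k))"
      unfolding embed_val_def by (simp only: embed_L2_scale[OF T_meas val_L2])
    also have "\<dots> = norm (embed_val (b k *\<^sub>R F.u k))"
      by (simp only: F.iota.scaleR[symmetric] fc_\<omega>)
    also have "\<dots> = \<bar>b k * norm (embed_val (F.u k))\<bar>"
      by (simp add: F.iota.scaleR abs_mult)
    finally show "norm (norm_L2 T (\<lambda>t. fc k * val (\<omega> k) t)) \<le> (b k)\<^sup>2 + (norm (embed_val (F.u k)))\<^sup>2"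
      using abs_le[of "b k" "norm (embed_val (F.u k))"] by simp
  qed

  \<comment> \<open>The quadratic identities\<close>
  have \<gamma>: "inverse (\<gamma> k) = inverse (\<nu> k) - 1" for k
    unfolding assms(19) by simp
  \<comment> \<open>The weight \<open>1 + inverse (\<gamma> k)\<close> is
    \<open>inverse (\<nu> k)\<close>, also for \<open>\<nu> k = 1\<close>, and cancels the factor
    \<open>\<nu> k\<close> in \<open>fc2\<close>.\<close>
  have weighted: "(1 + inverse (\<gamma> k)) * (fc k)\<^sup>2 = (b k)\<^sup>2"
    and penalty: "inverse (\<gamma> k) * (fc k)\<^sup>2 = (b k)\<^sup>2 - (fc k)\<^sup>2" for k
    unfolding \<gamma> fc2 using \<nu>_pos[of k] by (simp_all add: field_simps)
  have R_sums: "(\<lambda>k. (1 + inverse (\<gamma> k)) * (fc k)\<^sup>2) sums inner_R T val C J f f"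
    unfolding weighted inner_R b_def by (rule F.Parseval)
  have C_sums: "(\<lambda>k. (fc k)\<^sup>2) sums inner_L2 T (integral_op T C (val f)) (val f)"
    unfolding fc2 C_form b_def by (rule F.C_Parseval)
  have J_eq: "J f = inner_R T val C J f f - inner_L2 T (integral_op T C (val f)) (val f)"
    unfolding inner_R C_form B_def J by (simp add: power2_norm_eq_inner)
  have J_sums: "(\<lambda>k. inverse (\<gamma> k) * (fc k)\<^sup>2) sums J f"
    using sums_diff[OF R_sums C_sums] unfolding J_eq weighted penalty .
  show ?thesis
    using w \<omega> pointwise norm_summable f_sums R_sums C_sums J_eq J_sums by simp
qed

end
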